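(* Let $G$ be an Eulerian plane triangulation with at least three big vertices, let $B$ be the set of big vertices, let $\{V_1,V_2,V_3\}$ be the unique partition of $V(G)$ into three independent sets, and let $\mathcal{B}=\{B\cap V_1,B\cap V_2,B\cap V_3\}$. The following are equivalent: (a) there exists a partition of $V(G)$ into two subsets each of which induces a forest in $G$; (b) there exists a partition $\mathcal{L}$ of $B$ into two parts which is compatible with $\mathcal{B}$ (with respect to the plane graph $G[B]$) and such that each part of $\mathcal{L}$ induces a forest in $G[B]$.
   Context: All graphs are finite and simple. An Eulerian plane triangulation is a plane graph in which every face is bounded by a $3$-cycle and every vertex has even degree; it has a unique partition of its vertex set into three independent sets. A vertex is big if its degree is at least $6$. $G[B]$ is the induced subgraph with the embedding inherited from $G$. Compatibility: for a plane graph $J$ and a partition $\mathcal{J}$ of $V(J)$ into three (possibly empty) independent sets, a partition $\mathcal{K}$ of $V(J)$ into two subsets is compatible with $\mathcal{J}$ if every facial $4$-cycle of $J$ has two non-consecutive vertices which either belong to the same part of $\mathcal{K}$ and the same part of $\mathcal{J}$, or belong to distinct parts of $\mathcal{K}$ and distinct parts of $\mathcal{J}$. *)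

theory Defs
  imports "HOL-Analysis.Analysis"
begin

text \<open>
  A plane graph is given by a finite set of points of the plane (identified with \<open>complex\<close>),
  a set of two-element sets of vertices, and, for every such edge, a parametrised arc in the
  plane joining its two end vertices.  The values of \<open>curve\<close> outside \<open>edges\<close> are irrelevant.
\<close>

record drawn_graph =
  verts :: "complex set"
  edges :: "complex set set"
  curve :: "complex set \<Rightarrow> real \<Rightarrow> complex"

definition plane_graph :: "drawn_graph \<Rightarrow> bool" where
  "plane_graph G \<longleftrightarrow>
     finite (verts G) \<and>
     (\<forall>e\<in>edges G. e \<subseteq> verts G \<and> card e = 2) \<and>
     (\<forall>e\<in>edges G. arc (curve G e) \<and> {pathstart (curve G e), pathfinish (curve G e)} = e) \<and>
     (\<forall>e\<in>edges G. path_image (curve G e) \<inter> verts G = e) \<and>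
     (\<forall>e\<in>edges G. \<forall>f\<in>edges G. e \<noteq> f \<longrightarrow>
        path_image (curve G e) \<inter> path_image (curve G f) = e \<inter> f)"

definition degree :: "drawn_graph \<Rightarrow> complex \<Rightarrow> nat" where
  "degree G v = card {e \<in> edges G. v \<in> e}"

definition induced :: "drawn_graph \<Rightarrow> complex set \<Rightarrow> drawn_graph" where
  "induced G S = \<lparr>verts = verts G \<inter> S, edges = {e \<in> edges G. e \<subseteq> S}, curve = curve G\<rparr>"

text \<open>Cycles are written as lists of their vertices in cyclic order.\<close>

definition cycle_edges :: "complex list \<Rightarrow> complex set set" where
  "cycle_edges c = {{c ! i, c ! (Suc i mod length c)} | i. i < length c}"

definition is_cycle :: "drawn_graph \<Rightarrow> complex list \<Rightarrow> bool" where
  "is_cycle G c \<longleftrightarrow>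
     3 \<le> length c \<and> distinct c \<and> set c \<subseteq> verts G \<and> cycle_edges c \<subseteq> edges G"

definition forest :: "drawn_graph \<Rightarrow> bool" where
  "forest G \<longleftrightarrow> (\<nexists>c. is_cycle G c)"

definition independent :: "drawn_graph \<Rightarrow> complex set \<Rightarrow> bool" where
  "independent G S \<longleftrightarrow> S \<subseteq> verts G \<and> (\<forall>u\<in>S. \<forall>v\<in>S. {u, v} \<notin> edges G)"

definition support :: "drawn_graph \<Rightarrow> complex set" where
  "support G = verts G \<union> (\<Union>e\<in>edges G. path_image (curve G e))"

definition faces :: "drawn_graph \<Rightarrow> complex set set" where
  "faces G = components (- support G)"

text \<open>The whole boundary of the face has to be the cycle: a face with further parts of the graph
  on its boundary (other components, pendant edges) is not bounded by that cycle.\<close>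

definition bounded_by_cycle :: "drawn_graph \<Rightarrow> complex set \<Rightarrow> complex list \<Rightarrow> bool" where
  "bounded_by_cycle G F c \<longleftrightarrow>
     is_cycle G c \<and> frontier F = (\<Union>e\<in>cycle_edges c. path_image (curve G e))"

definition facial_cycle :: "drawn_graph \<Rightarrow> complex list \<Rightarrow> bool" where
  "facial_cycle G c \<longleftrightarrow> (\<exists>F\<in>faces G. bounded_by_cycle G F c)"

definition eulerian_plane_triangulation :: "drawn_graph \<Rightarrow> bool" where
  "eulerian_plane_triangulation G \<longleftrightarrow>
     plane_graph G \<and>
     (\<forall>F\<in>faces G. \<exists>c. length c = 3 \<and> bounded_by_cycle G F c) \<and>
     (\<forall>v\<in>verts G. even (degree G v))"

definition big_verts :: "drawn_graph \<Rightarrow> complex set" where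
  "big_verts G = {v \<in> verts G. 6 \<le> degree G v}"

text \<open>Partitions into a fixed number of parts, where empty parts are allowed.\<close>

definition two_partition :: "'a set \<Rightarrow> 'a set \<Rightarrow> 'a set \<Rightarrow> bool" where
  "two_partition X K1 K2 \<longleftrightarrow> K1 \<union> K2 = X \<and> K1 \<inter> K2 = {}"

definition three_partition :: "'a set \<Rightarrow> 'a set \<Rightarrow> 'a set \<Rightarrow> 'a set \<Rightarrow> bool" where
  "three_partition X J1 J2 J3 \<longleftrightarrow>
     J1 \<union> J2 \<union> J3 = X \<and> J1 \<inter> J2 = {} \<and> J1 \<inter> J3 = {} \<and> J2 \<inter> J3 = {}"

definition same_part :: "'a set set \<Rightarrow> 'a \<Rightarrow> 'a \<Rightarrow> bool" where
  "same_part P u v \<longleftrightarrow> (\<exists>X\<in>P. u \<in> X \<and> v \<in> X)"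

definition distinct_parts :: "'a set set \<Rightarrow> 'a \<Rightarrow> 'a \<Rightarrow> bool" where
  "distinct_parts P u v \<longleftrightarrow> (\<exists>X\<in>P. \<exists>Y\<in>P. X \<noteq> Y \<and> u \<in> X \<and> v \<in> Y)"

text \<open>\<open>compatible J \<J> \<K>\<close>: the partition \<open>\<K>\<close> is compatible with \<open>\<J>\<close> in \<open>J\<close>.  In the cycle
  \<open>[a, b, c, d]\<close> the pairs of non-consecutive vertices are \<open>a, c\<close> and \<open>b, d\<close>.\<close>

definition compatible :: "drawn_graph \<Rightarrow> complex set set \<Rightarrow> complex set set \<Rightarrow> bool" where
  "compatible J \<J> \<K> \<longleftrightarrow>
     (\<forall>a b c d. facial_cycle J [a, b, c, d] \<longrightarrow>
        (\<exists>(u, v) \<in> {(a, c), (b, d)}.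
           same_part \<K> u v \<and> same_part \<J> u v \<or>
           distinct_parts \<K> u v \<and> distinct_parts \<J> u v))"

end

theory Submission
  imports Defs
begin

text \<open>
  Every face is one side of its boundary triangle, and every edge lies on exactly two faces, so the
  link of a vertex of degree 4 is a 4-cycle.  A connected group of small vertices is therefore either
  a facial triangle inscribed in a triangle of \<open>G[B]\<close>, or a path both of whose sides are coned
  off by two big poles \<open>x\<close>, \<open>y\<close>; the open star of the group is then a face of \<open>G[B]\<close>, in
  the second case bounded by the 4-cycle through the two big ends of the path and the poles, and these
  are all the facial 4-cycles.

  If the poles are in different parts of a partition into forests, the path has to alternate between
  the parts, just as it alternates between the two colour classes avoiding the poles; this is
  compatibility.  Conversely a compatible partition extends over one group at a time.  The only
  delicate case is that of two poles in the same part: either the whole path goes to the other part,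
  or a single vertex of it joins the poles.  If both choices created a cycle, the two cycles would
  cross at a single vertex, against the Jordan curve theorem.
\<close>

section \<open>Plane graphs and Jordan curves\<close>

text \<open>The local structure is read off from the faces alone, without Euler's formula. The
  device is \<open>cell\<close>: each point of the plane is labelled with the vertices of the open
  vertex, edge or face containing it, so that lying in a closed edge or closed face becomes
  inclusion of finite sets, and the frontier of a union of open stars (\<open>region\<close>) can be
  computed. Once every edge has its two facial triangles, plane topology serves only to recognise
  faces of \<open>G[B]\<close>, to exclude degenerate graphs and to cross two cycles. The degenerate
  graphs are the reason for asking for three big vertices. Two faces with the same corners leave a
  single triangle; a small corner of the triangle around an inscribed small triangle completes an
  octahedron; a path of small vertices that closes up gives a double wheel. In the last two cases
  the frontier of the star lies in a set that does not separate the plane, so nothing remains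
  outside and at most two vertices can be big. Coinciding ends of a path are excluded similarly, but
  there three candidates survive and the degree of the common end decides.\<close>

fun path_edges :: "complex list \<Rightarrow> complex set set" where
  "path_edges (a # b # vs) = insert {a, b} (path_edges (b # vs))"
| "path_edges _ = {}"

lemma path_edges_nth: "path_edges vs = {{vs ! i, vs ! Suc i} | i. Suc i < length vs}"
proof (induction vs rule: path_edges.induct)
  case (1 a b vs)
  have "{{(a # b # vs) ! i, (a # b # vs) ! Suc i} | i. Suc i < length (a # b # vs)} =
    insert {a, b} {{(b # vs) ! i, (b # vs) ! Suc i} | i. Suc i < length (b # vs)}" (is "?L = ?R")
  proof (rule set_eqI)
    fix e
    show "e \<in> ?L \<longleftrightarrow> e \<in> ?R"
    proof
      assume "e \<in> ?L"
      then obtain i where "e = {(a # b # vs) ! i, (a # b # vs) ! Suc i}" "Suc i < length (a # b # vs)"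
        by blast
      then show "e \<in> ?R" by (cases i) auto
    next
      assume e: "e \<in> ?R"
      show "e \<in> ?L"
      proof (cases "e = {a, b}")
        case True
        then show ?thesis by (auto intro!: exI[of _ 0])
      next
        case False
        with e obtain i where "e = {(b # vs) ! i, (b # vs) ! Suc i}" "Suc i < length (b # vs)"
          by blast
        then show ?thesis by (auto intro!: exI[of _ "Suc i"])
      qed
    qed
  qed
  then show ?case using 1 by simp
qed auto

text \<open>Trades indices modulo the length for list recursion plus one closing edge, the form in
  which arcs are joined later.\<close>

lemma cycle_edges_eq:
  assumes "c \<noteq> []"
  shows "cycle_edges c = insert {last c, hd c} (path_edges c)"
proof -
  have "{..<length c} = insert (length c - 1) {i. Suc i < length c}"
    using assms by (cases c) auto
  moreover have "cycle_edges c = (\<lambda>i. {c ! i, c ! (Suc i mod length c)}) ` {..<length c}"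
    unfolding cycle_edges_def by auto
  moreover have "path_edges c = (\<lambda>i. {c ! i, c ! (Suc i mod length c)}) ` {i. Suc i < length c}"
    unfolding path_edges_nth by auto
  moreover have "{c ! (length c - 1), c ! (Suc (length c - 1) mod length c)} = {last c, hd c}"
    using assms by (simp add: last_conv_nth hd_conv_nth)
  ultimately show ?thesis by simp
qed

lemma path_edges_append:
  "xs \<noteq> [] \<Longrightarrow> ys \<noteq> [] \<Longrightarrow>
   path_edges (xs @ ys) = insert {last xs, hd ys} (path_edges xs \<union> path_edges ys)"
proof (induction xs rule: path_edges.induct)
  case ("2_2" v)
  then show ?case by (cases ys) auto
qed auto

lemma path_edges_subset: "e \<in> path_edges vs \<Longrightarrow> e \<subseteq> set vs"
  by (induction vs rule: path_edges.induct) auto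

lemma cycle_edges_rotate:
  assumes "xs \<noteq> []" "ys \<noteq> []"
  shows "cycle_edges (xs @ ys) = cycle_edges (ys @ xs)"
  using assms by (simp add: cycle_edges_eq path_edges_append insert_commute Un_commute)

text \<open>Thanks to this, all forests can be discussed through cycles of \<open>G\<close> and
  their vertex sets.\<close>

lemma is_cycle_induced: "is_cycle (induced G X) c \<longleftrightarrow> is_cycle G c \<and> set c \<subseteq> X"
proof -
  have "e \<subseteq> set c" if "e \<in> cycle_edges c" for e
  proof -
    have "c \<noteq> []" using that by (auto simp: cycle_edges_def)
    then show ?thesis using that path_edges_subset[of e c] by (auto simp: cycle_edges_eq)
  qed
  then have "cycle_edges c \<subseteq> {e \<in> edges G. e \<subseteq> X} \<longleftrightarrow> cycle_edges c \<subseteq> edges G" if "set c \<subseteq> X"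
    using that by blast
  then show ?thesis unfolding is_cycle_def induced_def by auto
qed

lemma is_cycle_rotate:
  assumes c: "is_cycle G c" and u: "u \<in> set c"
  obtains vs where "is_cycle G (u # vs)" "set (u # vs) = set c"
    "cycle_edges (u # vs) = cycle_edges c"
proof -
  obtain xs ys where s: "c = xs @ u # ys" using u by (meson split_list)
  have "cycle_edges (u # ys @ xs) = cycle_edges c"
    using cycle_edges_rotate[of xs "u # ys"] s by (cases xs) auto
  then show thesis
    using that[of "ys @ xs"] c s unfolding is_cycle_def by auto
qed

lemma is_cycle_Cons:
  "is_cycle G (u # vs) \<longleftrightarrow> 2 \<le> length vs \<and> distinct (u # vs) \<and> set (u # vs) \<subseteq> verts G \<and>
     {u, hd vs} \<in> edges G \<and> {u, last vs} \<in> edges G \<and> path_edges vs \<subseteq> edges G"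
proof (cases vs)
  case (Cons a as)
  then show ?thesis
    unfolding is_cycle_def by (auto simp: cycle_edges_eq insert_commute)
qed (auto simp: is_cycle_def)

lemma cycle_neighbours:
  assumes c: "is_cycle G c" and u: "u \<in> set c"
  obtains p q where "p \<noteq> q" "p \<in> set c" "q \<in> set c" "p \<noteq> u" "q \<noteq> u"
    "{u, p} \<in> edges G" "{u, q} \<in> edges G"
proof -
  obtain vs where vs: "is_cycle G (u # vs)" "set (u # vs) = set c"
    using is_cycle_rotate[OF c u] .
  then have l: "2 \<le> length vs" "distinct (u # vs)" unfolding is_cycle_Cons by auto
  then have "vs \<noteq> []" by auto
  have "hd vs \<noteq> last vs"
    using l by (cases vs) (auto simp: last_conv_nth split: if_splits)
  moreover have "hd vs \<in> set vs" "last vs \<in> set vs" using \<open>vs \<noteq> []\<close> by auto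
  ultimately show thesis
    using that[of "hd vs" "last vs"] vs l unfolding is_cycle_Cons by auto
qed

text \<open>A connected set larger than \<open>R\<close> would have to meet the frontier of
  \<open>R\<close>, which lies in \<open>X\<close>. This is the common test for faces, Jordan
  domains and open stars.\<close>

lemma component_of_compl_closed:
  assumes "open R" "connected R" "R \<noteq> {}" "R \<inter> X = {}" "frontier R \<subseteq> X"
  shows "R \<in> components (- X)"
  unfolding in_components_maximal
proof (intro conjI allI impI)
  fix D assume D: "D \<noteq> {} \<and> R \<subseteq> D \<and> D \<subseteq> - X \<and> connected D"
  show "D = R"
  proof (rule ccontr)
    assume "D \<noteq> R"
    then have "D \<inter> R \<noteq> {}" "D - R \<noteq> {}" using D assms by auto
    then have "D \<inter> frontier R \<noteq> {}" using connected_Int_frontier D by blast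
    then show False using assms D by auto
  qed
qed (use assms in auto)

lemma components_eqI:
  "C \<in> components S \<Longrightarrow> D \<in> components S \<Longrightarrow> C \<inter> D \<noteq> {} \<Longrightarrow> C = D"
  using components_nonoverlap by blast

text \<open>The inverse of the parametrisation would embed an open piece of the plane into the line,
  against invariance of dimension.\<close>

lemma interior_arc_empty:
  fixes g :: "real \<Rightarrow> complex"
  assumes "arc g"
  shows "interior (path_image g) = {}"
proof (rule ccontr)
  assume ne: "interior (path_image g) \<noteq> {}"
  obtain h where h: "homeomorphism {0..1} (path_image g) g h"
    using homeomorphism_arc[OF assms] .
  have "continuous_on (path_image g) h" "inj_on h (path_image g)"
    using h by (auto simp: homeomorphism_def inj_on_def) metis
  then have "continuous_on (interior (path_image g)) h" "inj_on h (interior (path_image g))"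
    by (meson continuous_on_subset inj_on_subset interior_subset)+
  then have "DIM(complex) \<le> DIM(real)"
    using invariance_of_dimension[of "interior (path_image g)" h] ne by blast
  then show False by simp
qed

lemma interior_Union_closed_empty:
  assumes "finite \<A>" "\<And>S. S \<in> \<A> \<Longrightarrow> closed S" "\<And>S. S \<in> \<A> \<Longrightarrow> interior S = {}"
  shows "interior (\<Union>\<A>) = {}"
  using assms
proof (induction \<A> rule: finite_induct)
  case (insert S \<A>)
  then show ?case using interior_closed_Un_empty_interior[of S "\<Union>\<A>"] by simp
qed simp

lemma empty_interior_finite: "finite (S :: complex set) \<Longrightarrow> interior S = {}"
  by (meson finite_imp_not_open finite_subset interior_subset open_interior)

section \<open>Drawn edges, cycles as Jordan curves, and the faces of a drawing\<close>

locale drawn_plane_graph =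
  fixes G :: drawn_graph
  assumes plane: "plane_graph G"
begin

abbreviation arc_of :: "complex set \<Rightarrow> complex set" where
  "arc_of e \<equiv> path_image (curve G e)"

abbreviation carrier_of :: "complex set set \<Rightarrow> complex set" where
  "carrier_of E \<equiv> (\<Union>e\<in>E. arc_of e)"

lemma finite_verts: "finite (verts G)"
  using plane by (simp add: plane_graph_def)

lemma edge_subset: "e \<in> edges G \<Longrightarrow> e \<subseteq> verts G"
  and edge_card: "e \<in> edges G \<Longrightarrow> card e = 2"
  and arc_curve: "e \<in> edges G \<Longrightarrow> arc (curve G e)"
  and curve_ends: "e \<in> edges G \<Longrightarrow> {pathstart (curve G e), pathfinish (curve G e)} = e"
  and arc_of_verts: "e \<in> edges G \<Longrightarrow> arc_of e \<inter> verts G = e"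
  and arc_of_Int: "e \<in> edges G \<Longrightarrow> f \<in> edges G \<Longrightarrow> e \<noteq> f \<Longrightarrow> arc_of e \<inter> arc_of f = e \<inter> f"
  using plane by (simp_all add: plane_graph_def)

lemma finite_edges: "finite (edges G)"
  using finite_subset[of "edges G" "Pow (verts G)"] finite_verts edge_subset by auto

lemma edge_neq: "{a, b} \<in> edges G \<Longrightarrow> a \<noteq> b"
  using edge_card by fastforce

lemma edge_verts: "{a, b} \<in> edges G \<Longrightarrow> a \<in> verts G \<and> b \<in> verts G"
  using edge_subset by blast

lemma edge_doubleton: "e \<in> edges G \<Longrightarrow> \<exists>a b. e = {a, b} \<and> a \<noteq> b"
  using edge_card by (meson card_2_iff)

lemma compact_arc_of: "e \<in> edges G \<Longrightarrow> compact (arc_of e)"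
  using arc_curve compact_arc_image by blast

lemma closed_arc_of: "e \<in> edges G \<Longrightarrow> closed (arc_of e)"
  using compact_arc_of compact_imp_closed by blast

lemma connected_arc_of: "e \<in> edges G \<Longrightarrow> connected (arc_of e)"
  using arc_curve connected_arc_image by blast

lemma edge_subset_arc_of: "e \<in> edges G \<Longrightarrow> e \<subseteq> arc_of e"
  using arc_of_verts by blast

lemma carrier_path_edges_Int_verts:
  assumes "path_edges vs \<subseteq> edges G" "2 \<le> length vs"
  shows "carrier_of (path_edges vs) \<inter> verts G = set vs"
  using assms
proof (induction vs rule: path_edges.induct)
  case (1 a b vs)
  then show ?case
    using arc_of_verts[of "{a, b}"] by (cases vs) (auto simp: Int_Un_distrib2)
qed auto

lemma arc_of_carrier_Int:
  assumes "e \<in> edges G" "E \<subseteq> edges G" "e \<notin> E"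
  shows "arc_of e \<inter> carrier_of E = e \<inter> \<Union>E"
  using assms arc_of_Int by blast

lemma oriented_edge:
  assumes "{a, b} \<in> edges G"
  obtains g where "arc g" "pathstart g = a" "pathfinish g = b" "path_image g = arc_of {a, b}"
proof -
  let ?c = "curve G {a, b}"
  have "(pathstart ?c = a \<and> pathfinish ?c = b) \<or> (pathstart ?c = b \<and> pathfinish ?c = a)"
    using curve_ends[OF assms] by (auto simp: doubleton_eq_iff)
  then show thesis
    using that[of ?c] that[of "reversepath ?c"] arc_curve[OF assms] arc_reversepath by fastforce
qed

lemma Union_path_edges: "2 \<le> length vs \<Longrightarrow> \<Union>(path_edges vs) = set vs"
proof (induction vs rule: path_edges.induct)
  case (1 a b vs)
  then show ?case by (cases vs) auto
qed auto

lemma path_arc: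
  assumes "distinct vs" "2 \<le> length vs" "path_edges vs \<subseteq> edges G"
  shows "\<exists>g. arc g \<and> pathstart g = hd vs \<and> pathfinish g = last vs \<and>
    path_image g = carrier_of (path_edges vs)"
  using assms
proof (induction vs rule: path_edges.induct)
  case (1 a b vs)
  have e: "{a, b} \<in> edges G" using 1 by simp
  obtain g1 where g1: "arc g1" "pathstart g1 = a" "pathfinish g1 = b" "path_image g1 = arc_of {a, b}"
    using oriented_edge[OF e] .
  show ?case
  proof (cases vs)
    case Nil
    then show ?thesis using g1 by auto
  next
    case (Cons d ds)
    then obtain g2 where g2: "arc g2" "pathstart g2 = b" "pathfinish g2 = last vs"
      "path_image g2 = carrier_of (path_edges (b # vs))"
      using 1 by auto
    have "{a, b} \<notin> path_edges (b # vs)"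
      using path_edges_subset[of "{a, b}" "b # vs"] 1 by auto
    then have "path_image g1 \<inter> path_image g2 = {a, b} \<inter> \<Union>(path_edges (b # vs))"
      using arc_of_carrier_Int[OF e, of "path_edges (b # vs)"] 1 g1 g2 by simp
    also have "\<dots> = {b}" using 1 Cons by (subst Union_path_edges) auto
    finally have "arc (g1 +++ g2)" using g1 g2 by (intro arc_join) auto
    moreover have "path_image (g1 +++ g2) = carrier_of (path_edges (a # b # vs))"
      using g1 g2 by (simp add: path_image_join)
    ultimately show ?thesis using g1 g2 Cons
      by (intro exI[of _ "g1 +++ g2"]) auto
  qed
qed auto

lemma connected_path_carrier:
  assumes "distinct vs" "2 \<le> length vs" "path_edges vs \<subseteq> edges G"
  shows "connected (carrier_of (path_edges vs))"
  using path_arc[OF assms] connected_arc_image by metis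

lemma cycle_simple_path:
  assumes "is_cycle G c"
  shows "\<exists>g. simple_path g \<and> pathfinish g = pathstart g \<and>
    path_image g = carrier_of (cycle_edges c)"
proof -
  have c: "3 \<le> length c" "distinct c" "cycle_edges c \<subseteq> edges G" "c \<noteq> []"
    using assms unfolding is_cycle_def by auto
  have ce: "cycle_edges c = insert {last c, hd c} (path_edges c)"
    using cycle_edges_eq c by blast
  obtain g where g: "arc g" "pathstart g = hd c" "pathfinish g = last c"
    "path_image g = carrier_of (path_edges c)"
    using path_arc[of c] c ce by auto
  have e: "{last c, hd c} \<in> edges G" using ce c by auto
  obtain g1 where g1: "arc g1" "pathstart g1 = last c" "pathfinish g1 = hd c"
    "path_image g1 = arc_of {last c, hd c}"
    using oriented_edge[OF e] .
  \<comment> \<open>The closing edge joins the positions \<open>length c - 1\<close> and 0; these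
    are consecutive in the list only for length 2, and a cycle has length at least 3.\<close>
  have "{last c, hd c} \<notin> path_edges c"
  proof
    assume "{last c, hd c} \<in> path_edges c"
    then obtain i where i: "Suc i < length c" "{last c, hd c} = {c ! i, c ! Suc i}"
      unfolding path_edges_nth by blast
    then have "(last c = c ! i \<and> hd c = c ! Suc i) \<or> (last c = c ! Suc i \<and> hd c = c ! i)"
      by (auto simp: doubleton_eq_iff)
    moreover have "last c = c ! (length c - 1)" "hd c = c ! 0"
      using c by (auto simp: last_conv_nth hd_conv_nth)
    ultimately have "(length c - 1 = i \<and> 0 = Suc i) \<or> (length c - 1 = Suc i \<and> 0 = i)"
      using c i by (auto simp: nth_eq_iff_index_eq)
    then show False using c by auto
  qed
  then have "path_image g \<inter> path_image g1 \<subseteq> {last c, hd c}"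
    using arc_of_carrier_Int[OF e, of "path_edges c"] ce c g g1 by auto
  then have "simple_path (g +++ g1)"
    using g g1 by (intro simple_path_join_loop) auto
  moreover have "path_image (g +++ g1) = carrier_of (cycle_edges c)"
    using g g1 ce by (simp add: path_image_join Un_commute)
  ultimately show ?thesis using g g1 by (intro exI[of _ "g +++ g1"]) auto
qed

lemma cycle_Jordan:
  assumes "is_cycle G c"
  obtains D1 D2 where "open D1" "open D2" "connected D1" "connected D2" "D1 \<noteq> {}" "D2 \<noteq> {}"
    "D1 \<inter> D2 = {}" "D1 \<union> D2 = - carrier_of (cycle_edges c)"
    "frontier D1 = carrier_of (cycle_edges c)" "frontier D2 = carrier_of (cycle_edges c)"
proof -
  obtain g where g: "simple_path g" "pathfinish g = pathstart g"
    "path_image g = carrier_of (cycle_edges c)"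
    using cycle_simple_path[OF assms] by blast
  show thesis
    using Jordan_inside_outside[OF g(1,2)] g(3)
    by (intro that[of "inside (path_image g)" "outside (path_image g)"]) auto
qed

lemma closed_support: "closed (support G)"
  unfolding support_def
  by (intro closed_Un finite_imp_closed finite_verts closed_UN finite_edges ballI closed_arc_of)

lemma interior_support: "interior (support G) = {}"
proof -
  have "support G = \<Union>(insert (verts G) (arc_of ` edges G))"
    unfolding support_def by simp
  moreover have "interior (\<Union>(insert (verts G) (arc_of ` edges G))) = {}"
    using finite_edges finite_verts closed_arc_of interior_arc_empty arc_curve
      empty_interior_finite[OF finite_verts] finite_imp_closed[OF finite_verts]
    by (intro interior_Union_closed_empty) auto
  ultimately show ?thesis by simp
qed

text \<open>The support is closed with empty interior, so its complement is dense. Hence every point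
  in the closure of an open set can be approached through faces.\<close>

lemma closure_diff_support:
  assumes "open D"
  shows "closure (D - support G) = closure D"
proof -
  have "closure (- support G) = UNIV"
    by (simp add: closure_complement interior_support)
  then show ?thesis
    using closure_open_Int_superset[OF assms, of "- support G"] by (simp add: Diff_eq)
qed

text \<open>A test point in the relative interior of each edge: whether an edge belongs to a
  frontier or to a union of arcs is decided at this point.\<close>

definition mid :: "complex set \<Rightarrow> complex" where
  "mid e = curve G e (1 / 2)"

lemma mid_in_arc_of: "mid e \<in> arc_of e"
  unfolding mid_def path_image_def by auto

lemma mid_notin_verts: "e \<in> edges G \<Longrightarrow> mid e \<notin> verts G"
proof
  assume e: "e \<in> edges G" and "mid e \<in> verts G"
  then have "mid e \<in> {pathstart (curve G e), pathfinish (curve G e)}"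
    using arc_of_verts[OF e] mid_in_arc_of[of e] curve_ends[OF e] by auto
  moreover have "inj_on (curve G e) {0..1}" using arc_curve[OF e] arc_imp_inj_on by blast
  ultimately show False
    unfolding mid_def pathstart_def pathfinish_def
    by (auto dest: inj_onD[of _ _ "1/2" 0] inj_onD[of _ _ "1/2" 1])
qed

lemma mid_in_arc_of_iff: "e \<in> edges G \<Longrightarrow> f \<in> edges G \<Longrightarrow> mid e \<in> arc_of f \<longleftrightarrow> e = f"
  using arc_of_Int[of e f] mid_in_arc_of[of e] mid_notin_verts[of e] edge_subset[of f] by blast

lemma mid_in_carrier_iff:
  "e \<in> edges G \<Longrightarrow> E \<subseteq> edges G \<Longrightarrow> mid e \<in> carrier_of E \<longleftrightarrow> e \<in> E"
  using mid_in_arc_of_iff by blast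

text \<open>The test points make a set of edges recoverable from its drawing; frontiers are compared
  with cycles in this way.\<close>

lemma carrier_subset_iff:
  "E \<subseteq> edges G \<Longrightarrow> E' \<subseteq> edges G \<Longrightarrow> carrier_of E \<subseteq> carrier_of E' \<longleftrightarrow> E \<subseteq> E'"
  using mid_in_arc_of mid_in_carrier_iff by (metis (no_types, lifting) SUP_subset_mono UN_I subset_eq)

lemma carrier_subset_support: "E \<subseteq> edges G \<Longrightarrow> carrier_of E \<subseteq> support G"
  unfolding support_def by auto

lemma faces_props:
  assumes "F \<in> faces G"
  shows "open F" "connected F" "F \<noteq> {}" "F \<inter> support G = {}" "frontier F \<subseteq> support G"
proof -
  have F: "F \<in> components (- support G)" using assms by (simp add: faces_def)
  show "open F" using open_components[OF _ F] closed_support by (simp add: open_Compl)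
  show "connected F" "F \<noteq> {}" using F in_components_connected in_components_nonempty by blast+
  show "F \<inter> support G = {}" using in_components_subset[OF F] by blast
  show "frontier F \<subseteq> support G"
    using frontier_of_components_closed_complement[OF closed_support F] .
qed

lemma faces_disjoint: "F \<in> faces G \<Longrightarrow> F' \<in> faces G \<Longrightarrow> F \<inter> F' \<noteq> {} \<Longrightarrow> F = F'"
  unfolding faces_def using components_eqI by blast

lemma Union_faces: "\<Union>(faces G) = - support G"
  unfolding faces_def by (rule Union_components)

end

section \<open>Faces of the triangulation\<close>

locale eulerian_triangulation =
  fixes G :: drawn_graph
  assumes triangulation: "eulerian_plane_triangulation G"
    and three_big: "3 \<le> card (big_verts G)"
begin

sublocale drawn_plane_graph
  using triangulation by unfold_locales (simp add: eulerian_plane_triangulation_def)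

abbreviation B :: "complex set" where "B \<equiv> big_verts G"

lemma B_verts: "B \<subseteq> verts G"
  by (auto simp: big_verts_def)

definition corners :: "complex set \<Rightarrow> complex set" where
  "corners F = verts G \<inter> frontier F"

lemma face_triangle:
  assumes "F \<in> faces G"
  obtains a b c where "corners F = {a, b, c}" "a \<noteq> b" "b \<noteq> c" "c \<noteq> a"
    "{a, b} \<in> edges G" "{b, c} \<in> edges G" "{c, a} \<in> edges G" "is_cycle G [a, b, c]"
    "frontier F = carrier_of {{a, b}, {b, c}, {c, a}}"
    "cycle_edges [a, b, c] = {{a, b}, {b, c}, {c, a}}"
proof -
  obtain c where c: "length c = 3" "bounded_by_cycle G F c"
    using assms triangulation unfolding eulerian_plane_triangulation_def by blast
  then obtain x y z where xyz: "c = [x, y, z]"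
    by (auto simp: numeral_3_eq_3 length_Suc_conv)
  have cyc: "is_cycle G [x, y, z]" and fr: "frontier F = carrier_of (cycle_edges [x, y, z])"
    using c xyz unfolding bounded_by_cycle_def by auto
  have ce: "cycle_edges [x, y, z] = {{x, y}, {y, z}, {z, x}}"
    by (auto simp: cycle_edges_eq)
  have e: "{x, y} \<in> edges G" "{y, z} \<in> edges G" "{z, x} \<in> edges G"
    using cyc ce unfolding is_cycle_def by auto
  have "corners F = {x, y, z}"
    unfolding corners_def fr ce using e[THEN arc_of_verts] by auto
  moreover have "x \<noteq> y" "y \<noteq> z" "z \<noteq> x" using cyc unfolding is_cycle_def by auto
  ultimately show thesis using that e cyc fr ce by metis
qed

lemma card_corners: "F \<in> faces G \<Longrightarrow> card (corners F) = 3"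
  by (erule face_triangle) auto

lemma corners_verts: "corners F \<subseteq> verts G"
  by (simp add: corners_def)

lemma corners_edge:
  assumes "F \<in> faces G" "p \<in> corners F" "q \<in> corners F" "p \<noteq> q"
  shows "{p, q} \<in> edges G"
  using assms(1)
proof (rule face_triangle)
  fix a b c
  assume c: "corners F = {a, b, c}" "{a, b} \<in> edges G" "{b, c} \<in> edges G" "{c, a} \<in> edges G"
  have "{p, q} = {a, b} \<or> {p, q} = {b, c} \<or> {p, q} = {c, a}"
    using assms c(1) by auto
  then show ?thesis using c by metis
qed

lemma edges_in_triangle:
  assumes "{a, b} \<in> edges G" "{b, c} \<in> edges G" "{c, a} \<in> edges G"
  shows "{e \<in> edges G. e \<subseteq> {a, b, c}} = {{a, b}, {b, c}, {c, a}}"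
proof -
  have "e \<in> {{a, b}, {b, c}, {c, a}}" if "e \<in> edges G" "e \<subseteq> {a, b, c}" for e
  proof -
    obtain p q where "e = {p, q}" "p \<noteq> q" using edge_doubleton \<open>e \<in> edges G\<close> by blast
    then show ?thesis using that by auto
  qed
  then show ?thesis using assms by auto
qed

text \<open>In a simple graph three corners span no edges but those of their triangle, so the
  frontier depends on \<open>corners F\<close> only.\<close>

lemma face_frontier:
  assumes "F \<in> faces G"
  shows "frontier F = carrier_of {e \<in> edges G. e \<subseteq> corners F}"
  using assms by (rule face_triangle) (simp add: edges_in_triangle)

lemma face_apex:
  assumes F: "F \<in> faces G" and e: "{a, b} \<in> edges G" "{a, b} \<subseteq> corners F"
  obtains c where "corners F = {a, b, c}" "c \<noteq> a" "c \<noteq> b" "{b, c} \<in> edges G" "{c, a} \<in> edges G"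
    "frontier F = arc_of {a, b} \<union> arc_of {b, c} \<union> arc_of {c, a}"
proof -
  have ab: "a \<noteq> b" using edge_neq e by blast
  obtain x y z where x: "corners F = {x, y, z}" "x \<noteq> y" "y \<noteq> z" "z \<noteq> x"
    using face_triangle[OF F] by metis
  then obtain c where c: "corners F = {a, b, c}" "c \<noteq> a" "c \<noteq> b"
    using e ab by auto
  then have "{b, c} \<in> edges G" "{c, a} \<in> edges G"
    using corners_edge[OF F] by auto
  moreover from this have "frontier F = arc_of {a, b} \<union> arc_of {b, c} \<union> arc_of {c, a}"
    using face_frontier[OF F] edges_in_triangle[of a b c] c e by auto
  ultimately show thesis using that c by blast
qed

lemma face_component:
  assumes "F \<in> faces G"
  shows "F \<in> components (- frontier F)"
  using faces_props[OF assms] by (intro component_of_compl_closed) (auto simp: frontier_def interior_open)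

text \<open>\<open>F\<close> is itself a component of the complement of its boundary triangle, hence
  one of the two Jordan domains, bounded or not; \<open>D\<close> is the other one.\<close>

lemma face_other_side:
  assumes F: "F \<in> faces G"
  obtains D where "open D" "connected D" "D \<noteq> {}" "D \<inter> F = {}" "D \<union> F = - frontier F"
    "frontier D = frontier F" "D \<in> components (- frontier F)"
proof -
  obtain a b c where c: "is_cycle G [a, b, c]" "frontier F = carrier_of (cycle_edges [a, b, c])"
    using face_triangle[OF F] by metis
  obtain D1 D2 where D: "open D1" "open D2" "connected D1" "connected D2" "D1 \<noteq> {}" "D2 \<noteq> {}"
    "D1 \<inter> D2 = {}" "D1 \<union> D2 = - frontier F" "frontier D1 = frontier F" "frontier D2 = frontier F"
    using cycle_Jordan[OF c(1)] unfolding c(2) by metis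
  have "D1 \<in> components (- frontier F)" "D2 \<in> components (- frontier F)"
    using D by (auto intro!: component_of_compl_closed)
  moreover have "F \<inter> D1 \<noteq> {} \<or> F \<inter> D2 \<noteq> {}"
    using D faces_props[OF F] by blast
  ultimately have "F = D1 \<or> F = D2" using components_eqI face_component[OF F] by blast
  then show thesis
    using that[of D1] that[of D2] D \<open>D1 \<in> _\<close> \<open>D2 \<in> _\<close> by (auto simp: Int_commute Un_commute)
qed

lemma faces_same_frontier:
  assumes "F1 \<in> faces G" "F2 \<in> faces G" "F1 \<noteq> F2" "frontier F1 = frontier F2"
  shows "F1 \<union> F2 \<union> frontier F1 = UNIV"
proof -
  obtain D where D: "D \<inter> F1 = {}" "D \<union> F1 = - frontier F1" "D \<in> components (- frontier F1)"
    using face_other_side[OF assms(1)] by metis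
  have "F2 \<inter> F1 = {}" using faces_disjoint assms by blast
  moreover have "F2 \<subseteq> - frontier F1" "F2 \<noteq> {}"
    using face_component[OF assms(2)] assms in_components_subset in_components_nonempty by auto
  ultimately have "F2 \<inter> D \<noteq> {}" using D by blast
  then have "F2 = D" using D face_component[OF assms(2)] assms components_eqI by metis
  then show ?thesis using D by auto
qed

text \<open>Equal corners give equal frontiers, so by the Jordan curve theorem both faces and their
  common triangle fill the plane and \<open>G\<close> has at most three edges. Then no vertex has
  degree 6, against \<open>three_big\<close>.\<close>

lemma corners_inj:
  assumes F: "F1 \<in> faces G" "F2 \<in> faces G" "corners F1 = corners F2"
  shows "F1 = F2"
proof (rule ccontr)
  assume ne: "F1 \<noteq> F2"
  have fr: "frontier F1 = frontier F2" using face_frontier F by simp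
  have "F1 \<union> F2 \<union> frontier F1 = UNIV" using faces_same_frontier F ne fr by blast
  moreover have "verts G \<inter> (F1 \<union> F2) = {}"
    using faces_props F unfolding support_def by blast
  ultimately have "verts G = corners F1" unfolding corners_def by blast
  moreover obtain a b c where abc: "corners F1 = {a, b, c}" "{a, b} \<in> edges G" "{b, c} \<in> edges G"
    "{c, a} \<in> edges G" using face_triangle[OF F(1)] by metis
  ultimately have "{e \<in> edges G. e \<subseteq> {a, b, c}} = edges G"
    using edge_subset by auto
  then have "edges G = {{a, b}, {b, c}, {c, a}}"
    using edges_in_triangle[OF abc(2,3,4)] by simp
  then have "card (edges G) \<le> 3" by (auto simp: card_insert_if)
  moreover have "card {e \<in> edges G. v \<in> e} \<le> card (edges G)" for v
    using finite_edges by (intro card_mono) auto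
  ultimately have "degree G v < 6" for v
    unfolding degree_def using order.trans[of "card {e \<in> edges G. v \<in> e}" "card (edges G)" 3] by simp
  then have "B = {}" unfolding big_verts_def by (auto simp: not_le)
  then show False using three_big by simp
qed

lemma finite_faces: "finite (faces G)"
proof -
  have "inj_on corners (faces G)" using corners_inj by (rule inj_onI)
  moreover have "corners ` faces G \<subseteq> Pow (verts G)" using corners_verts by auto
  ultimately show ?thesis
    using finite_verts by (meson finite_Pow_iff finite_imageD finite_subset)
qed

text \<open>The finitely many sets \<open>closure (D \<inter> F)\<close> have a closed union, and it
  contains \<open>D - support G\<close>, which is dense in \<open>D\<close>.\<close>

lemma closure_meets_face:
  assumes "open D" "p \<in> closure D"
  obtains F where "F \<in> faces G" "p \<in> closure (D \<inter> F)"
proof -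
  let ?U = "\<Union>F\<in>faces G. closure (D \<inter> F)"
  have "D - support G \<subseteq> ?U"
  proof
    fix q assume q: "q \<in> D - support G"
    then obtain F where "F \<in> faces G" "q \<in> F" using Union_faces by blast
    then show "q \<in> ?U" using q closure_subset[of "D \<inter> F"] by blast
  qed
  moreover have "closed ?U" using finite_faces by (intro closed_UN) auto
  ultimately have "closure (D - support G) \<subseteq> ?U" by (rule closure_minimal)
  then have "p \<in> ?U" using assms closure_diff_support[OF assms(1)] by auto
  then show thesis using that by blast
qed

lemma in_closure_face: obtains F where "F \<in> faces G" "p \<in> closure F"
  using closure_meets_face[of UNIV p] by auto

lemma closure_face: "closure F = F \<union> frontier F"
  by (simp add: closure_Un_frontier)

lemma mid_frontier_face:
  assumes "F \<in> faces G" "e \<in> edges G"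
  shows "mid e \<in> closure F \<longleftrightarrow> e \<subseteq> corners F"
proof -
  have "mid e \<notin> F"
    using faces_props(4)[OF assms(1)] assms(2) mid_in_arc_of[of e] unfolding support_def by blast
  then show ?thesis
    using face_frontier[OF assms(1)] mid_in_carrier_iff[OF assms(2), of "{e \<in> edges G. e \<subseteq> corners F}"]
      assms(2) by (simp add: closure_face)
qed

text \<open>A face that meets \<open>D\<close> stays in \<open>D\<close>: it is connected and misses
  the support, where the frontier of \<open>D\<close> lies.\<close>

lemma face_at_side:
  assumes e: "e \<in> edges G" and D: "open D" "mid e \<in> closure D" "frontier D \<subseteq> support G"
  obtains F where "F \<in> faces G" "F \<subseteq> D" "e \<subseteq> corners F"
proof -
  obtain F where F: "F \<in> faces G" "mid e \<in> closure (D \<inter> F)"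
    using closure_meets_face[OF D(1,2)] .
  then have "mid e \<in> closure F" by (meson Int_lower2 closure_mono subsetD)
  then have "e \<subseteq> corners F" using mid_frontier_face F e by blast
  moreover have "F \<subseteq> D"
  proof (rule ccontr)
    assume "\<not> F \<subseteq> D"
    moreover have "F \<inter> D \<noteq> {}" using F by (auto simp: Int_commute)
    ultimately have "F \<inter> frontier D \<noteq> {}"
      using connected_Int_frontier faces_props(2)[OF F(1)] by blast
    then show False using D faces_props(4)[OF F(1)] by blast
  qed
  ultimately show thesis using that F by blast
qed

text \<open>The second face is sought on the other Jordan side of the first. That side has the same
  frontier, so \<open>mid e\<close> lies in its closure as well.\<close>

lemma edge_in_two_faces:
  assumes e: "e \<in> edges G"
  obtains F1 F2 where "F1 \<in> faces G" "F2 \<in> faces G" "F1 \<noteq> F2" "e \<subseteq> corners F1" "e \<subseteq> corners F2"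
proof -
  obtain F1 where F1: "F1 \<in> faces G" "e \<subseteq> corners F1"
    using in_closure_face mid_frontier_face e by metis
  obtain D where D: "open D" "D \<inter> F1 = {}" "frontier D = frontier F1"
    using face_other_side[OF F1(1)] by metis
  have "mid e \<in> frontier F1"
    using face_frontier[OF F1(1)] F1 e mid_in_arc_of by blast
  then have "mid e \<in> closure D" using D(3) by (metis DiffD1 frontier_def)
  then obtain F2 where F2: "F2 \<in> faces G" "F2 \<subseteq> D" "e \<subseteq> corners F2"
    using face_at_side[OF e D(1)] D faces_props(5)[OF F1(1)] by metis
  have "F1 \<noteq> F2" using F2(2) D(2) faces_props(3)[OF F1(1)] by auto
  then show thesis using that F1 F2 by metis
qed

text \<open>Two further faces at an edge of the face \<open>F1\<close> lie on the same side of \<open>F1\<close>; near the edge they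
  can also be joined off the remaining arcs of the other boundary, so by Janiszewski's theorem
  the boundary of \<open>F2\<close> does not separate them.\<close>

lemma edge_in_at_most_two_faces:
  assumes e: "e \<in> edges G" and F: "F1 \<in> faces G" "F2 \<in> faces G" "F3 \<in> faces G"
    and c: "e \<subseteq> corners F1" "e \<subseteq> corners F2" "e \<subseteq> corners F3"
    and ne: "F1 \<noteq> F2" "F1 \<noteq> F3"
  shows "F2 = F3"
proof (rule ccontr)
  assume ne3: "F2 \<noteq> F3"
  obtain a b where ab: "e = {a, b}" "a \<noteq> b" using edge_doubleton[OF e] by blast
  obtain c1 where c1: "corners F1 = {a, b, c1}" "c1 \<noteq> a" "c1 \<noteq> b" "{b, c1} \<in> edges G"
    "{c1, a} \<in> edges G" "frontier F1 = arc_of {a, b} \<union> arc_of {b, c1} \<union> arc_of {c1, a}"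
    using face_apex[OF F(1), of a b] e c ab by metis
  obtain c2 where c2: "corners F2 = {a, b, c2}" "c2 \<noteq> a" "c2 \<noteq> b" "{b, c2} \<in> edges G"
    "{c2, a} \<in> edges G" "frontier F2 = arc_of {a, b} \<union> arc_of {b, c2} \<union> arc_of {c2, a}"
    using face_apex[OF F(2), of a b] e c ab by metis
  have c12: "c1 \<noteq> c2" using c1 c2 corners_inj F ne by metis
  let ?a1 = "arc_of {b, c1} \<union> arc_of {c1, a}" and ?a2 = "arc_of {b, c2} \<union> arc_of {c2, a}"
  let ?S = "frontier F1" and ?T = "?a1 \<union> ?a2"
  have e': "{a, b} \<in> edges G" using e ab by simp
  have abne: "{a, b} \<noteq> {b, c1}" "{a, b} \<noteq> {c1, a}" "{a, b} \<noteq> {b, c2}" "{a, b} \<noteq> {c2, a}"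
    using ab c1 c2 by (auto simp: doubleton_eq_iff)
  have ne12: "{b, c1} \<noteq> {b, c2}" "{b, c1} \<noteq> {c2, a}" "{c1, a} \<noteq> {b, c2}" "{c1, a} \<noteq> {c2, a}"
    using ab c1 c2 c12 by (auto simp: doubleton_eq_iff)
  have "arc_of {a, b} \<inter> ?T \<subseteq> {a, b}"
    using arc_of_Int[OF e' c1(4) abne(1)] arc_of_Int[OF e' c1(5) abne(2)]
      arc_of_Int[OF e' c2(4) abne(3)] arc_of_Int[OF e' c2(5) abne(4)] by blast
  moreover have "{a, b, c1} \<subseteq> ?a1" 
    using c1(4,5)[THEN edge_subset_arc_of] by auto
  \<comment> \<open>The intersection is the path from \<open>b\<close> to \<open>a\<close> through
    \<open>c1\<close>. Its connectedness is the crucial hypothesis of Janiszewski's theorem.\<close>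
  ultimately have ST: "?S \<inter> ?T = ?a1" using c1 by auto
  have "c1 \<in> arc_of {b, c1} \<inter> arc_of {c1, a}"
    using c1(4,5)[THEN edge_subset_arc_of] by auto
  then have con1: "connected ?a1"
    using c1(4,5) by (intro connected_Un connected_arc_of) auto
  have closT: "closed ?T" using c1(4,5) c2(4,5) by (intro closed_Un closed_arc_of)
  \<comment> \<open>A small disc around the midpoint meets no edge of \<open>?T\<close>, so it joins
    \<open>F2\<close> to \<open>F3\<close> off \<open>?T\<close>, possibly across \<open>e\<close>
    itself.\<close>
  have "mid {a, b} \<notin> ?T"
    using e' c1(4,5) c2(4,5) abne mid_in_arc_of_iff by (metis Un_iff)
  then obtain r where r: "r > 0" "ball (mid e) r \<subseteq> - ?T"
    using open_contains_ball_eq[OF open_Compl[OF closT]] unfolding ab by (metis ComplI)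
  have "mid e \<in> closure F2" "mid e \<in> closure F3"
    using F c e mid_frontier_face by auto
  then obtain p2 p3 where p: "p2 \<in> F2" "p2 \<in> ball (mid e) r" "p3 \<in> F3" "p3 \<in> ball (mid e) r"
    using r(1) unfolding closure_approachable by (metis dist_commute mem_ball)
  have "connected_component (- ?T) p2 p3"
    using p(2,4) r(2) connected_ball unfolding connected_component_def by metis
  moreover obtain D where D: "connected D" "D \<inter> F1 = {}" "D \<union> F1 = - ?S"
    using face_other_side[OF F(1)] by metis
  have "F2 \<inter> F1 = {}" "F3 \<inter> F1 = {}"
    using faces_disjoint F ne by metis+
  then have "F2 \<union> F3 \<subseteq> D"
    using D(3) faces_props(4)[OF F(2)] faces_props(4)[OF F(3)] faces_props(5)[OF F(1)] by blast
  then have "p2 \<in> D" "p3 \<in> D" using p(1,3) by auto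
  then have "connected_component (- ?S) p2 p3"
    using D(1,3) unfolding connected_component_def by (metis Un_upper1)
  moreover have "compact ?S"
    using c1(4,5) e' unfolding c1(6) by (intro compact_Un compact_arc_of)
  ultimately have "connected_component (- (?S \<union> ?T)) p2 p3"
    using Janiszewski[of ?S ?T p2 p3] closT con1 ST by simp
  then obtain U where U: "connected U" "U \<subseteq> - (?S \<union> ?T)" "p2 \<in> U" "p3 \<in> U"
    unfolding connected_component_def by blast
  \<comment> \<open>The frontier of \<open>F2\<close> is part of \<open>?S \<union> ?T\<close>, so
    the connected set \<open>U\<close> cannot leave \<open>F2\<close>, although it contains the
    point \<open>p3\<close> of \<open>F3\<close>.\<close>
  have "U \<inter> frontier F2 = {}" using U(2) unfolding c1(6) c2(6) by auto
  then have "U \<subseteq> F2" using connected_Int_frontier[OF U(1), of F2] U(3) p(1) by auto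
  moreover have "F2 \<inter> F3 = {}" using faces_disjoint F ne3 by metis
  ultimately show False using U(4) p(3) by auto
qed

text \<open>Stated through a face, so that separating 3-cycles do not count; comparing sets of
  corners makes the relation invariant under all permutations.\<close>

definition facial_triangle :: "complex \<Rightarrow> complex \<Rightarrow> complex \<Rightarrow> bool" ("tr") where
  "tr a b c \<longleftrightarrow> (\<exists>F\<in>faces G. corners F = {a, b, c})"

lemma tr_perm: "tr a b c \<Longrightarrow> tr b a c" "tr a b c \<Longrightarrow> tr a c b"
  unfolding facial_triangle_def by (simp_all add: insert_commute)

lemma tr_commute: "tr a b c \<longleftrightarrow> tr b a c" "tr a b c \<longleftrightarrow> tr a c b"
  using tr_perm by blast+

lemma tr_edges:
  assumes "tr a b c"
  shows "{a, b} \<in> edges G" "{b, c} \<in> edges G" "{c, a} \<in> edges G" "a \<noteq> b" "b \<noteq> c" "c \<noteq> a"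
proof -
  obtain F where F: "F \<in> faces G" "corners F = {a, b, c}"
    using assms unfolding facial_triangle_def by blast
  have "card {a, b, c} = 3" using card_corners F by metis
  then show ne: "a \<noteq> b" "b \<noteq> c" "c \<noteq> a" by (auto simp: card_insert_if split: if_splits)
  show "{a, b} \<in> edges G" "{b, c} \<in> edges G" "{c, a} \<in> edges G"
    using corners_edge[OF F(1)] F(2) ne by simp_all
qed

text \<open>The combinatorial yield of the Jordan curve arguments: turning around a vertex means
  passing from one of these two apexes to the other.\<close>

lemma edge_two_triangles:
  assumes e: "{a, b} \<in> edges G"
  obtains c d where "c \<noteq> d" "\<And>x. tr a b x \<longleftrightarrow> x = c \<or> x = d"
proof -
  obtain F1 F2 where F: "F1 \<in> faces G" "F2 \<in> faces G" "F1 \<noteq> F2"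
    "{a, b} \<subseteq> corners F1" "{a, b} \<subseteq> corners F2"
    using edge_in_two_faces[OF e] by metis
  obtain c where c: "corners F1 = {a, b, c}" "c \<noteq> a" "c \<noteq> b"
    using face_apex[OF F(1) e F(4)] by metis
  obtain d where d: "corners F2 = {a, b, d}" "d \<noteq> a" "d \<noteq> b"
    using face_apex[OF F(2) e F(5)] by metis
  show thesis
  proof
    show "c \<noteq> d" using c d corners_inj F by metis
    show "tr a b x \<longleftrightarrow> x = c \<or> x = d" for x
    proof
      assume x: "tr a b x"
      then obtain F where F3: "F \<in> faces G" "corners F = {a, b, x}"
        unfolding facial_triangle_def by blast
      then have "F = F1 \<or> F = F2"
        using edge_in_at_most_two_faces[OF e F(1,2) F3(1) F(4,5) _ F(3)] by fastforce
      then have "{a, b, x} = {a, b, c} \<or> {a, b, x} = {a, b, d}" using F3 c d by auto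
      then show "x = c \<or> x = d" using tr_edges(4-6)[OF x] by auto
    next
      assume "x = c \<or> x = d"
      then show "tr a b x" unfolding facial_triangle_def using c(1) d(1) F(1,2) by metis
    qed
  qed
qed

end

section \<open>Cells and open stars\<close>

context eulerian_triangulation
begin

text \<open>The vertices of the open cell (vertex, edge or face) that contains \<open>q\<close>.\<close>

definition cell :: "complex \<Rightarrow> complex set" where
  "cell q = (if q \<in> verts G then {q}
     else if q \<in> support G then (THE e. e \<in> edges G \<and> q \<in> arc_of e)
     else corners (THE F. F \<in> faces G \<and> q \<in> F))"

lemma cell_vertex: "v \<in> verts G \<Longrightarrow> cell v = {v}"
  by (simp add: cell_def)

lemma cell_edge:
  assumes e: "e \<in> edges G" "q \<in> arc_of e" "q \<notin> verts G"
  shows "cell q = e"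
proof -
  have uniq: "f = e" if "f \<in> edges G" "q \<in> arc_of f" for f
  proof (rule ccontr)
    assume "f \<noteq> e"
    then have "q \<in> f \<inter> e" using arc_of_Int[of f e] that e by blast
    then show False using edge_subset[OF e(1)] e(3) by blast
  qed
  have "(THE e. e \<in> edges G \<and> q \<in> arc_of e) = e" 
  proof (rule the_equality)
    show "e \<in> edges G \<and> q \<in> arc_of e" using e(1,2) by simp
    show "f = e" if "f \<in> edges G \<and> q \<in> arc_of f" for f using uniq that by simp
  qed
  moreover have "q \<in> support G" using e unfolding support_def by auto
  ultimately show ?thesis using e by (simp add: cell_def)
qed

lemma cell_face:
  assumes F: "F \<in> faces G" "q \<in> F"
  shows "cell q = corners F"
proof -
  have "(THE F. F \<in> faces G \<and> q \<in> F) = F"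
  proof (rule the_equality)
    show "F \<in> faces G \<and> q \<in> F" using F by simp
    show "F' = F" if "F' \<in> faces G \<and> q \<in> F'" for F'
      using faces_disjoint[of F' F] that F by auto
  qed
  moreover have "q \<notin> support G" using faces_props(4)[OF F(1)] F(2) by blast
  ultimately show ?thesis by (auto simp: cell_def support_def)
qed

lemma cell_cases:
  obtains (vertex) "q \<in> verts G" "cell q = {q}"
  | (edge) e where "e \<in> edges G" "q \<in> arc_of e" "q \<notin> verts G" "cell q = e"
  | (face) F where "F \<in> faces G" "q \<in> F" "cell q = corners F" "q \<notin> support G"
proof -
  consider "q \<in> verts G" | e where "q \<notin> verts G" "e \<in> edges G" "q \<in> arc_of e"
    | F where "F \<in> faces G" "q \<in> F"
    using Union_faces unfolding support_def by blast
  then show thesis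
  proof cases
    case 3
    then have "q \<notin> support G" using faces_props(4) by blast
    then show thesis using 3 that(3) cell_face by blast
  qed (use that cell_vertex cell_edge in blast)+
qed

lemma cell_card: "q \<notin> support G \<Longrightarrow> card (cell q) = 3"
  by (cases q rule: cell_cases) (auto simp: support_def card_corners)

text \<open>A closed edge consists of its open arc and its two ends, whose cells are exactly those
  with vertices in \<open>e\<close>; a face is ruled out by its three corners.\<close>

lemma arc_of_iff_cell:
  assumes e: "e \<in> edges G"
  shows "q \<in> arc_of e \<longleftrightarrow> cell q \<subseteq> e"
proof (cases q rule: cell_cases)
  case vertex
  then show ?thesis using arc_of_verts[OF e] by auto
next
  case (edge f)
  have "f = e" if "f \<subseteq> e"
    using that edge_card[OF e] edge_card[OF edge(1)]
    by (intro card_subset_eq) (auto intro: card_ge_0_finite)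
  then show ?thesis using edge cell_edge[OF e] by auto
next
  case (face F)
  have "finite e" using edge_card[OF e] by (intro card_ge_0_finite) simp
  then have "\<not> corners F \<subseteq> e"
    using card_corners[OF face(1)] edge_card[OF e] card_mono[of e "corners F"] by auto
  moreover have "q \<notin> arc_of e" using face e unfolding support_def by auto
  ultimately show ?thesis using face by simp
qed

text \<open>A closed face is the open face with its boundary triangle. For the converse,
  \<open>corners_inj\<close> is what prevents a second face with the same corners.\<close>

lemma closure_face_iff_cell:
  assumes F: "F \<in> faces G"
  shows "q \<in> closure F \<longleftrightarrow> cell q \<subseteq> corners F"
proof
  assume "q \<in> closure F"
  then consider "q \<in> F" | e where "e \<in> edges G" "e \<subseteq> corners F" "q \<in> arc_of e"
    unfolding closure_face using face_frontier[OF F] by auto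
  then show "cell q \<subseteq> corners F"
  proof cases
    case 1
    then show ?thesis using cell_face[OF F] by simp
  next
    case 2
    then show ?thesis using arc_of_iff_cell by blast
  qed
next
  assume c: "cell q \<subseteq> corners F"
  show "q \<in> closure F"
  proof (cases q rule: cell_cases)
    case vertex
    then show ?thesis using c by (auto simp: corners_def closure_face)
  next
    case (edge e)
    then show ?thesis using c face_frontier[OF F] by (auto simp: closure_face)
  next
    case (face F')
    have "finite (corners F)" using finite_verts corners_verts finite_subset by blast
    then have "corners F' = corners F"
      using c face card_corners F by (intro card_subset_eq) auto
    then have "F' = F" using corners_inj F face by blast
    then show ?thesis using face by (auto simp: closure_face)
  qed
qed

text \<open>The union of the open stars of the vertices in \<open>C\<close>.\<close>

definition region :: "complex set \<Rightarrow> complex set" where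
  "region C = {q. cell q \<inter> C \<noteq> {}}"

text \<open>The complement of the star is a finite union of closed cells, namely of those with no
  vertex in \<open>C\<close>.\<close>

lemma open_region: "open (region C)"
proof -
  let ?N = "(\<Union>F\<in>{F \<in> faces G. corners F \<inter> C = {}}. closure F) \<union>
    carrier_of {e \<in> edges G. e \<inter> C = {}} \<union> (verts G - C)"
  have "q \<in> - region C \<longleftrightarrow> q \<in> ?N" for q
  proof
    assume q: "q \<in> - region C"
    show "q \<in> ?N"
      by (cases q rule: cell_cases) (use q in \<open>auto simp: region_def closure_face\<close>)
  next
    assume "q \<in> ?N"
    then consider F where "F \<in> faces G" "corners F \<inter> C = {}" "q \<in> closure F"
      | e where "e \<in> edges G" "e \<inter> C = {}" "q \<in> arc_of e" | "q \<in> verts G - C"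
      by auto
    then show "q \<in> - region C"
    proof cases
      case 1
      then show ?thesis using closure_face_iff_cell by (auto simp: region_def)
    next
      case 2
      then show ?thesis using arc_of_iff_cell by (auto simp: region_def)
    qed (auto simp: region_def cell_vertex)
  qed
  then have "- region C = ?N" by (rule set_eqI)
  moreover have "closed ?N"
    using finite_faces finite_edges finite_verts closed_arc_of
    by (intro closed_Un closed_UN finite_imp_closed) auto
  ultimately show ?thesis using open_closed by metis
qed

lemma face_subset_region: "F \<in> faces G \<Longrightarrow> corners F \<inter> C \<noteq> {} \<Longrightarrow> F \<subseteq> region C"
  using cell_face by (auto simp: region_def)

text \<open>The star is a union, over the faces at \<open>v\<close>, of sets lying between a face
  and its closure; these are connected and all contain \<open>v\<close>.\<close>

lemma connected_star:
  assumes v: "v \<in> verts G"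
  shows "connected (region {v})"
proof -
  let ?W = "\<lambda>F. {q \<in> closure F. v \<in> cell q}"
  let ?\<W> = "?W ` {F \<in> faces G. v \<in> corners F}"
  have "region {v} = \<Union>?\<W>"
  proof
    show "region {v} \<subseteq> \<Union>?\<W>"
    proof
      fix q assume q: "q \<in> region {v}"
      obtain F where F: "F \<in> faces G" "q \<in> closure F" by (rule in_closure_face)
      then have "v \<in> corners F" using q closure_face_iff_cell by (auto simp: region_def)
      then show "q \<in> \<Union>?\<W>" using F q by (auto simp: region_def)
    qed
  qed (auto simp: region_def)
  moreover have "connected (\<Union>?\<W>)"
  proof (rule connected_Union)
    fix W assume "W \<in> ?\<W>"
    then obtain F where F: "F \<in> faces G" "v \<in> corners F" "W = ?W F" by blast
    have "F \<subseteq> W" using F cell_face closure_subset by fastforce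
    then show "connected W"
      using connected_intermediate_closure[OF faces_props(2)[OF F(1)]] F(3) by blast
  next
    have "v \<in> \<Inter>?\<W>" using v by (auto simp: cell_vertex closure_face corners_def)
    then show "\<Inter>?\<W> \<noteq> {}" by blast
  qed
  ultimately show ?thesis by simp
qed

lemma region_Un: "region (C \<union> D) = region C \<union> region D"
  by (auto simp: region_def)

lemma region_edge_overlap:
  assumes e: "{a, b} \<in> edges G"
  shows "mid {a, b} \<in> region {a}" "mid {a, b} \<in> region {b}"
  using cell_edge[OF e mid_in_arc_of mid_notin_verts[OF e]] by (auto simp: region_def)

text \<open>The stars of consecutive vertices overlap in the midpoint of their common edge.\<close>

lemma connected_region:
  assumes "vs \<noteq> []" "set vs \<subseteq> verts G" "successively (\<lambda>a b. {a, b} \<in> edges G) vs"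
  shows "connected (region (set vs))"
  using assms
proof (induction vs)
  case (Cons a vs)
  show ?case
  proof (cases vs)
    case Nil
    then show ?thesis using Cons connected_star by simp
  next
    case (Cons b ws)
    then have e: "{a, b} \<in> edges G" using Cons.prems by simp
    have "connected (region (set vs))" "connected (region {a})"
      using Cons Cons.prems Cons.IH connected_star by auto
    moreover have "mid {a, b} \<in> region (set vs)"
      using region_edge_overlap[OF e] Cons by (auto simp: region_def)
    ultimately have "connected (region {a} \<union> region (set vs))"
      using region_edge_overlap[OF e] by (intro connected_Un) auto
    then show ?thesis using region_Un[of "{a}" "set vs"] by simp
  qed
qed simp

text \<open>The closure of the star is the union of the closed faces with a corner in
  \<open>C\<close>; taking away the open star leaves the cells without a vertex in
  \<open>C\<close>.\<close>

lemma frontier_region: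
  "q \<in> frontier (region C) \<longleftrightarrow>
     cell q \<inter> C = {} \<and> (\<exists>F\<in>faces G. corners F \<inter> C \<noteq> {} \<and> cell q \<subseteq> corners F)"
proof -
  let ?\<F> = "{F \<in> faces G. corners F \<inter> C \<noteq> {}}"
  have "closure (region C) = (\<Union>F\<in>?\<F>. closure F)"
  proof
    have "region C \<subseteq> (\<Union>F\<in>?\<F>. closure F)"
    proof
      fix q assume q: "q \<in> region C"
      obtain F where F: "F \<in> faces G" "q \<in> closure F" by (rule in_closure_face)
      then have "corners F \<inter> C \<noteq> {}" using q closure_face_iff_cell by (auto simp: region_def)
      then show "q \<in> (\<Union>F\<in>?\<F>. closure F)" using F by auto
    qed
    moreover have "closed (\<Union>F\<in>?\<F>. closure F)" using finite_faces by (intro closed_UN) auto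
    ultimately show "closure (region C) \<subseteq> (\<Union>F\<in>?\<F>. closure F)" by (rule closure_minimal)
    show "(\<Union>F\<in>?\<F>. closure F) \<subseteq> closure (region C)"
      by (intro UN_least closure_mono face_subset_region) auto
  qed
  then show ?thesis
    unfolding frontier_def interior_open[OF open_region]
    using closure_face_iff_cell by (auto simp: region_def)
qed

lemma region_nonempty: "v \<in> C \<Longrightarrow> v \<in> verts G \<Longrightarrow> v \<in> region C"
  by (simp add: region_def cell_vertex)

text \<open>A vertex left over would force the connected set \<open>- X\<close> to cross the
  frontier of the star, all of which lies in \<open>X\<close>. Applied with an arc or a pair of
  points as \<open>X\<close>, this shows that the whole graph has been seen.\<close>

lemma region_fills:
  assumes C: "C \<subseteq> verts G" "C \<noteq> {}" and X: "connected (- X)" "frontier (region C) \<subseteq> X"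
    "region C \<inter> X = {}"
  shows "verts G \<subseteq> C \<union> X"
proof
  fix v assume v: "v \<in> verts G"
  show "v \<in> C \<union> X"
  proof (rule ccontr)
    assume nv: "v \<notin> C \<union> X"
    then have "v \<in> - X - region C" using v by (auto simp: region_def cell_vertex)
    moreover obtain u where "u \<in> C" using C by blast
    then have "u \<in> - X \<inter> region C" using region_nonempty C X by blast
    ultimately have "- X \<inter> frontier (region C) \<noteq> {}"
      using connected_Int_frontier[OF X(1), of "region C"] by blast
    then show False using X by blast
  qed
qed

lemma support_induced: "q \<in> support (induced G X) \<longleftrightarrow> q \<in> support G \<and> cell q \<subseteq> X"
proof
  assume "q \<in> support (induced G X)"
  then show "q \<in> support G \<and> cell q \<subseteq> X"
    unfolding support_def induced_def using arc_of_iff_cell by (auto simp: cell_vertex)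
next
  assume q: "q \<in> support G \<and> cell q \<subseteq> X"
  show "q \<in> support (induced G X)"
    by (cases q rule: cell_cases) (use q in \<open>auto simp: support_def induced_def\<close>)
qed

text \<open>The star carries nothing of \<open>induced G X\<close> because \<open>vs\<close> avoids
  \<open>X\<close>. Its frontier is drawn there because the hypothesis on faces confines the
  vertices of frontier cells to \<open>X\<close>.\<close>

lemma region_face:
  assumes vs: "vs \<noteq> []" "set vs \<subseteq> verts G" "successively (\<lambda>a b. {a, b} \<in> edges G) vs"
    and X: "set vs \<inter> X = {}"
    and F: "\<And>F. F \<in> faces G \<Longrightarrow> corners F \<inter> set vs \<noteq> {} \<Longrightarrow> corners F \<subseteq> set vs \<union> X"
  shows "region (set vs) \<in> faces (induced G X)"
  unfolding faces_def
proof (rule component_of_compl_closed)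
  let ?R = "region (set vs)"
  show "open ?R" by (rule open_region)
  show "connected ?R" using vs by (rule connected_region)
  obtain v where "v \<in> set vs" using vs(1) by (cases vs) auto
  then show "?R \<noteq> {}" using region_nonempty vs(2) by blast
  show "?R \<inter> support (induced G X) = {}"
    using X by (fastforce simp: support_induced region_def)
  show "frontier ?R \<subseteq> support (induced G X)"
  proof
    fix q assume "q \<in> frontier ?R"
    then obtain F where q: "cell q \<inter> set vs = {}" "F \<in> faces G" "corners F \<inter> set vs \<noteq> {}"
      "cell q \<subseteq> corners F"
      unfolding frontier_region by blast
    \<comment> \<open>If \<open>q\<close> were inside a face, its cell would be all three corners of
      \<open>F\<close>, one of which belongs to \<open>vs\<close>.\<close>
    have "q \<in> support G"
    proof (rule ccontr)
      assume "q \<notin> support G"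
      then have "cell q = corners F"
        using cell_card card_corners[OF q(2)] q(4) finite_subset[OF corners_verts finite_verts]
        by (intro card_subset_eq) auto
      then show False using q by simp
    qed
    then show "q \<in> support (induced G X)"
      using q F[OF q(2,3)] by (auto simp: support_induced)
  qed
qed

lemma big_face:
  assumes F: "F \<in> faces G" "corners F \<subseteq> X"
  shows "F \<in> faces (induced G X)"
  unfolding faces_def
proof (rule component_of_compl_closed)
  show "F \<inter> support (induced G X) = {}" "frontier F \<subseteq> support (induced G X)"
    using faces_props(4,5)[OF F(1)] closure_face_iff_cell[OF F(1)] F(2) support_induced
    by (auto simp: frontier_def)
qed (use faces_props[OF F(1)] in auto)

text \<open>The cycle through \<open>u\<close>, \<open>x\<close> separates the plane, with the two faces at its edge \<open>{u, x}\<close> and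
  hence their further corners on different sides; the other cycle minus \<open>u\<close> would join them.\<close>

lemma cycles_cross:
  assumes P: "is_cycle G (u # ps)" and Q: "is_cycle G (u # qs)" and disj: "set ps \<inter> set qs = {}"
    and x: "hd ps = x" and w: "{hd qs, last qs} = {w, z}"
    and t: "\<And>r. tr u x r \<Longrightarrow> r = w \<or> r = z"
  shows False
proof -
  let ?K = "carrier_of (cycle_edges (u # ps))" and ?Q = "carrier_of (path_edges qs)"
  have P': "2 \<le> length ps" "distinct (u # ps)" "set (u # ps) \<subseteq> verts G" "{u, x} \<in> edges G"
    "path_edges ps \<subseteq> edges G" "{u, last ps} \<in> edges G"
    using P x unfolding is_cycle_Cons by auto
  have Q': "2 \<le> length qs" "distinct (u # qs)" "set (u # qs) \<subseteq> verts G" "path_edges qs \<subseteq> edges G"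
    using Q unfolding is_cycle_Cons by auto
  have ne: "ps \<noteq> []" "qs \<noteq> []" using P' Q' by auto
  have ceK: "cycle_edges (u # ps) = insert {u, last ps} (insert {u, x} (path_edges ps))"
    using ne x by (cases ps) (auto simp: cycle_edges_eq insert_commute)
  have sub: "cycle_edges (u # ps) \<subseteq> edges G" using P' ceK by auto
  have "?K \<inter> verts G = {u, last ps} \<union> {u, x} \<union> set ps"
    unfolding ceK using arc_of_verts P' carrier_path_edges_Int_verts[of ps] by (auto simp: Int_Un_distrib2)
  then have KV: "?K \<inter> verts G = set (u # ps)" using ne x by auto
  have QV: "?Q \<inter> verts G = set qs" using carrier_path_edges_Int_verts Q' by simp
  \<comment> \<open>Distinct edges meet only in common end vertices, and the two vertex sets
    \<open>set qs\<close> and \<open>set (u # ps)\<close> are disjoint.\<close>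
  have QK: "?Q \<inter> ?K = {}"
  proof (rule ccontr)
    assume "?Q \<inter> ?K \<noteq> {}"
    then obtain p e f where p: "p \<in> arc_of e" "p \<in> arc_of f" "e \<in> path_edges qs" "f \<in> cycle_edges (u # ps)"
      by blast
    have fs: "f \<subseteq> set (u # ps)" using p(4) ceK ne x path_edges_subset[of f ps] by auto
    have es: "e \<subseteq> set qs" using path_edges_subset p(3) by blast
    have ef: "e \<in> edges G" "f \<in> edges G" using p(3,4) Q' sub by auto
    have "e \<inter> f = {}" using es fs disj Q'(2) by auto
    moreover have "e \<noteq> {}" using edge_card[OF ef(1)] by auto
    ultimately have "arc_of e \<inter> arc_of f = {}" using arc_of_Int[OF ef] by auto
    then show False using p by blast
  qed
  have Qc: "connected ?Q" using connected_path_carrier Q' by simp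
  have wz: "w \<in> ?Q" "z \<in> ?Q" "w \<in> verts G" "z \<in> verts G"
  proof -
    have "{w, z} \<subseteq> set qs" unfolding w[symmetric] using ne by auto
    then show "w \<in> ?Q" "z \<in> ?Q" "w \<in> verts G" "z \<in> verts G" using QV by auto
  qed
  obtain D1 D2 where D: "open D1" "open D2" "D1 \<inter> D2 = {}" "D1 \<union> D2 = - ?K"
    "frontier D1 = ?K" "frontier D2 = ?K"
    using cycle_Jordan[OF P] by metis
  \<comment> \<open>To be used on both Jordan sides. The apex \<open>r\<close> is in the closure of
    \<open>D\<close> as a corner of a face inside \<open>D\<close>, and it is off \<open>?K\<close>
    because it lies on \<open>?Q\<close>; so it is in \<open>D\<close> itself.\<close>
  have corner: "\<exists>r. (r = w \<or> r = z) \<and> (\<exists>F\<in>faces G. corners F = {u, x, r} \<and> F \<subseteq> D) \<and> r \<in> D"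
    if D: "open D" "D \<subseteq> - ?K" "frontier D = ?K" for D
  proof -
    have "mid {u, x} \<in> frontier D" using D(3) ceK mid_in_arc_of by auto
    then have "mid {u, x} \<in> closure D" by (simp add: frontier_def)
    then obtain F where F: "F \<in> faces G" "F \<subseteq> D" "{u, x} \<subseteq> corners F"
      using face_at_side[OF P'(4) D(1)] D(3) carrier_subset_support[OF sub] by metis
    obtain r where r: "corners F = {u, x, r}" using face_apex[OF F(1) P'(4) F(3)] by metis
    then have rwz: "r = w \<or> r = z" using t F(1) unfolding facial_triangle_def by blast
    then have "r \<in> ?Q" using wz by auto
    then have "r \<notin> ?K" using QK by blast
    moreover have "r \<in> closure D"
      using closure_face_iff_cell[OF F(1), of r] r rwz wz closure_mono[OF F(2)]
      by (auto simp: cell_vertex)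
    ultimately have "r \<in> D" using D(3) by (auto simp: closure_Un_frontier)
    then show ?thesis using rwz r F by blast
  qed
  obtain r1 F1 where r1: "r1 = w \<or> r1 = z" "F1 \<in> faces G" "corners F1 = {u, x, r1}" "F1 \<subseteq> D1" "r1 \<in> D1"
    using corner[OF D(1)] D by blast
  obtain r2 F2 where r2: "r2 = w \<or> r2 = z" "F2 \<in> faces G" "corners F2 = {u, x, r2}" "F2 \<subseteq> D2" "r2 \<in> D2"
    using corner[OF D(2)] D by blast
  have "r1 \<in> ?Q" "r2 \<in> ?Q" using r1 r2 wz by auto
  then have "?Q \<inter> D1 \<noteq> {}" "?Q - D1 \<noteq> {}" using r1(5) r2(5) D(3) by auto
  then have "?Q \<inter> frontier D1 \<noteq> {}" using connected_Int_frontier[OF Qc] by blast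
  then show False using QK D(5) by auto
qed

end

section \<open>Links of small vertices\<close>

context eulerian_triangulation
begin

definition nbrs :: "complex \<Rightarrow> complex set" where
  "nbrs v = {u. {v, u} \<in> edges G}"

lemma nbrs_sym: "u \<in> nbrs v \<longleftrightarrow> v \<in> nbrs u"
  by (simp add: nbrs_def insert_commute)

lemma nbrs_verts: "nbrs v \<subseteq> verts G"
  using edge_verts by (auto simp: nbrs_def)

lemma finite_nbrs: "finite (nbrs v)"
  using nbrs_verts finite_verts finite_subset by blast

lemma not_self_nbr: "v \<notin> nbrs v"
  using edge_neq[of v v] by (auto simp: nbrs_def)

lemma degree_nbrs: "degree G v = card (nbrs v)"
proof -
  have "{e \<in> edges G. v \<in> e} = (\<lambda>u. {v, u}) ` nbrs v"
  proof (rule set_eqI)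
    fix e
    show "e \<in> {e \<in> edges G. v \<in> e} \<longleftrightarrow> e \<in> (\<lambda>u. {v, u}) ` nbrs v"
    proof
      assume e: "e \<in> {e \<in> edges G. v \<in> e}"
      then obtain a b where "e = {a, b}" using edge_doubleton by blast
      then have "e = {v, a} \<or> e = {v, b}" using e by auto
      then show "e \<in> (\<lambda>u. {v, u}) ` nbrs v" using e by (auto simp: nbrs_def)
    qed (auto simp: nbrs_def)
  qed
  moreover have "inj_on (\<lambda>u. {v, u}) (nbrs v)"
    by (rule inj_onI) (auto simp: doubleton_eq_iff)
  ultimately show ?thesis unfolding degree_def by (simp add: card_image)
qed

lemma tr_nbrs: "tr u a b \<Longrightarrow> a \<in> nbrs u \<and> b \<in> nbrs u \<and> b \<in> nbrs a"
  using tr_edges[of u a b] by (simp add: nbrs_def insert_commute)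

lemma nbr_triangles:
  assumes "a \<in> nbrs u" "tr u a b"
  obtains d where "d \<noteq> b" "\<And>x. tr u a x \<longleftrightarrow> x = b \<or> x = d"
proof -
  obtain c d where cd: "c \<noteq> d" "\<And>x. tr u a x \<longleftrightarrow> x = c \<or> x = d"
    using edge_two_triangles[of u a] assms(1) unfolding nbrs_def by blast
  then have "b = c \<or> b = d" using assms by simp
  then show thesis using that[of c] that[of d] cd by metis
qed

lemma vertex_triangle:
  assumes "v \<in> verts G"
  obtains a b where "tr v a b"
proof -
  obtain F where F: "F \<in> faces G" "v \<in> closure F" by (rule in_closure_face)
  then have v: "v \<in> corners F" using closure_face_iff_cell cell_vertex assms by auto
  obtain x y z where "corners F = {x, y, z}" using face_triangle[OF F(1)] by metis
  then have "corners F = {v, y, z} \<or> corners F = {v, x, z} \<or> corners F = {v, x, y}"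
    using v by auto
  then show thesis using that F(1) unfolding facial_triangle_def by metis
qed

definition small :: "complex set" where
  "small = verts G - B"

lemma small_degree: "u \<in> small \<Longrightarrow> even (card (nbrs u)) \<and> card (nbrs u) < 6"
  using triangulation degree_nbrs[of u]
  unfolding small_def big_verts_def eulerian_plane_triangulation_def by auto

text \<open>The link of \<open>u\<close> is the 4-cycle \<open>a, b, c, d\<close>.\<close>

definition link4 :: "complex \<Rightarrow> complex \<Rightarrow> complex \<Rightarrow> complex \<Rightarrow> complex \<Rightarrow> bool" where
  "link4 u a b c d \<longleftrightarrow> distinct [a, b, c, d] \<and> nbrs u = {a, b, c, d} \<and>
     (\<forall>p q. tr u p q \<longleftrightarrow> {p, q} \<in> {{a, b}, {b, c}, {c, d}, {d, a}})"

lemma link4_rotate: "link4 u a b c d \<Longrightarrow> link4 u b c d a"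
  unfolding link4_def by (auto simp: insert_commute)

lemma link4_reverse: "link4 u a b c d \<Longrightarrow> link4 u a d c b"
  unfolding link4_def by (auto simp: insert_commute)

lemma link4D:
  assumes "link4 u a b c d"
  shows "distinct [u, a, b, c, d]" "nbrs u = {a, b, c, d}" "tr u a b" "tr u b c" "tr u c d" "tr u d a"
  using assms not_self_nbr[of u] unfolding link4_def by auto

lemma link4_tr: "link4 u a b c d \<Longrightarrow>
    tr u p q \<longleftrightarrow> {p, q} = {a, b} \<or> {p, q} = {b, c} \<or> {p, q} = {c, d} \<or> {p, q} = {d, a}"
  unfolding link4_def by simp

lemma link4_tr_snd: "link4 u a b c d \<Longrightarrow> tr u a x \<longleftrightarrow> x = b \<or> x = d"
  using link4D(1)[of u a b c d] link4_tr[of u a b c d a x] by (auto simp: doubleton_eq_iff)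

text \<open>The two triangles at each edge make the link 2-regular. Starting from the edge
  \<open>a b\<close> of the link and continuing on both sides gives \<open>d, a, b, c\<close>; these
  are four neighbours, and an even degree below 6 leaves room for no more.\<close>

lemma link4_exists:
  assumes u: "u \<in> small" and ab: "tr u a b"
  obtains c d where "link4 u a b c d"
proof -
  have N: "even (card (nbrs u))" "card (nbrs u) < 6" using small_degree[OF u] by auto
  have ab': "a \<in> nbrs u" "b \<in> nbrs u" "a \<noteq> b" using tr_nbrs[OF ab] tr_edges[OF ab] by auto
  have ba: "tr u b a" using ab tr_commute by blast
  obtain d where d: "d \<noteq> b" "\<And>x. tr u a x \<longleftrightarrow> x = b \<or> x = d" using nbr_triangles[OF ab'(1) ab] by metis
  obtain c where c: "c \<noteq> a" "\<And>x. tr u b x \<longleftrightarrow> x = a \<or> x = c" using nbr_triangles[OF ab'(2) ba] by metis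
  have ad: "tr u a d" "tr u d a" and bc: "tr u b c" "tr u c b" using d c tr_commute by blast+
  have da: "d \<noteq> a" "d \<in> nbrs u" and cb: "c \<noteq> b" "c \<in> nbrs u"
    using tr_edges[OF ad(1)] tr_edges[OF bc(1)] tr_nbrs[OF ad(1)] tr_nbrs[OF bc(1)] by auto
  \<comment> \<open>A link component \<open>a, b, d\<close> of length 3 cannot be the whole link, by
    parity. Another neighbour \<open>e\<close> brings two more neighbours \<open>f\<close>,
    \<open>g\<close> outside that component, which makes six.\<close>
  have "c \<noteq> d"
  proof
    assume cd: "c = d"
    obtain d' where "d' \<noteq> a" and that': "\<And>x. tr u d x \<longleftrightarrow> x = a \<or> x = d'" using nbr_triangles[OF da(2) ad(2)] by metis
    then have dx: "tr u d x \<longleftrightarrow> x = a \<or> x = b" for x using \<open>d' \<noteq> a\<close> bc(2) cd ab'(3) that' by auto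
    have "card {a, b, d} = 3" using ab' da d by auto
    then have "nbrs u \<noteq> {a, b, d}" using N by auto
    then obtain e where e: "e \<in> nbrs u" "e \<notin> {a, b, d}" using ab' da by blast
    obtain f g where fg: "f \<noteq> g" "tr u e f" "tr u e g"
      using edge_two_triangles[of u e] e(1) unfolding nbrs_def by (metis mem_Collect_eq)
    have "r \<notin> {a, b, d}" if "tr u e r" for r
    proof -
      have "tr u r e" using that tr_perm(2) by simp
      then show ?thesis using e(2) d(2)[of e] c(2)[of e] dx[of e] cd by auto
    qed
    then have "f \<notin> {a, b, d}" "g \<notin> {a, b, d}" using fg by auto
    moreover have "f \<noteq> e" "g \<noteq> e" "f \<in> nbrs u" "g \<in> nbrs u"
      using tr_edges(5)[OF fg(2)] tr_edges(5)[OF fg(3)] tr_nbrs[OF fg(2)] tr_nbrs[OF fg(3)] by auto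
    ultimately have "card {a, b, d, e, f, g} = 6" "{a, b, d, e, f, g} \<subseteq> nbrs u"
      using fg(1) e ab' da d(1) by auto
    then show False using N(2) card_mono[OF finite_nbrs] by (metis not_le)
  qed
  then have abcd: "distinct [a, b, c, d]" using ab' da cb c d by auto
  then have card4: "card {a, b, c, d} = 4" by auto
  have sub: "{a, b, c, d} \<subseteq> nbrs u" using ab' da cb by auto
  then have "4 \<le> card (nbrs u)" using card_mono[OF finite_nbrs sub] card4 by simp
  then have "card (nbrs u) = 4 \<or> card (nbrs u) = 5" using N by linarith
  then have "card (nbrs u) = 4" using N(1) by auto
  then have nb: "nbrs u = {a, b, c, d}"
    using card_subset_eq[OF finite_nbrs sub] card4 by simp
  \<comment> \<open>All four neighbours are known, and both triangles at \<open>a\<close> are used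
    up, so the second triangle at \<open>c\<close> can only lead to \<open>d\<close>.\<close>
  obtain e where e: "e \<noteq> b" "\<And>x. tr u c x \<longleftrightarrow> x = b \<or> x = e" using nbr_triangles[OF cb(2) bc(2)] by metis
  have uce: "tr u c e" "tr u e c" using e(2) tr_commute by blast+
  have "e \<in> nbrs u" "e \<noteq> c" using tr_nbrs[OF uce(1)] tr_edges[OF uce(1)] by auto
  moreover have "e \<noteq> a" using d(2)[of c] uce(2) abcd by auto
  ultimately have "e = d" using nb e(1) by auto
  then have cx: "tr u c x \<longleftrightarrow> x = b \<or> x = d" for x using e(2) by simp
  obtain f where f: "f \<noteq> a" "\<And>x. tr u d x \<longleftrightarrow> x = a \<or> x = f" using nbr_triangles[OF da(2) ad(2)] by metis
  have "tr u d c" using uce(2) \<open>e = d\<close> by simp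
  then have dx: "tr u d x \<longleftrightarrow> x = a \<or> x = c" for x using f(2)[of c] f(2)[of x] c(1) by auto
  have "tr u p q \<longleftrightarrow> {p, q} \<in> {{a, b}, {b, c}, {c, d}, {d, a}}" for p q
  proof (cases "p \<in> {a, b, c, d}")
    case True
    then show ?thesis using abcd d(2)[of q] c(2)[of q] cx[of q] dx[of q] by (auto simp: doubleton_eq_iff)
  next
    case False
    moreover have "\<not> tr u p q" using False tr_nbrs nb by blast
    ultimately show ?thesis by (auto simp: doubleton_eq_iff)
  qed
  then show thesis using that abcd nb unfolding link4_def by blast
qed

lemma frontier_region_triangle:
  assumes "q \<in> frontier (region C)"
  obtains s p r where "s \<in> C" "tr s p r" "cell q \<subseteq> {p, r}" "cell q \<inter> C = {}"
proof -
  obtain F where F: "cell q \<inter> C = {}" "F \<in> faces G" "corners F \<inter> C \<noteq> {}" "cell q \<subseteq> corners F"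
    using assms unfolding frontier_region by blast
  obtain s where s: "s \<in> corners F" "s \<in> C" using F by blast
  obtain x y z where "corners F = {x, y, z}" using face_triangle[OF F(2)] by metis
  then have "\<exists>p r. corners F = {s, p, r}" using s(1) by auto
  then obtain p r where pr: "corners F = {s, p, r}" by blast
  then have "tr s p r" using F(2) unfolding facial_triangle_def by blast
  moreover have "cell q \<subseteq> {p, r}" using F(1,4) pr s(2) by auto
  ultimately show thesis using that s F by blast
qed

lemma region_face_nbrs:
  assumes vs: "vs \<noteq> []" "set vs \<subseteq> small" "successively (\<lambda>a b. {a, b} \<in> edges G) vs"
    and nb: "\<And>s. s \<in> set vs \<Longrightarrow> nbrs s \<subseteq> set vs \<union> B"
  shows "region (set vs) \<in> faces (induced G B)"
proof (rule region_face)
  show "set vs \<subseteq> verts G" "set vs \<inter> B = {}" using vs(2) by (auto simp: small_def)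
  fix F assume F: "F \<in> faces G" "corners F \<inter> set vs \<noteq> {}"
  then obtain s where s: "s \<in> corners F" "s \<in> set vs" by blast
  have "p \<in> nbrs s" if "p \<in> corners F" "p \<noteq> s" for p
    using corners_edge[OF F(1) s(1) that(1)] that by (simp add: nbrs_def)
  then show "corners F \<subseteq> set vs \<union> B" using nb[OF s(2)] s(2) by blast
qed (use vs in auto)

lemma big_not_within_two:
  assumes "B \<subseteq> {a, b}"
  shows False
proof -
  have "card B \<le> card {a, b}" using assms by (intro card_mono) auto
  also have "\<dots> \<le> 2" by (simp add: card_insert_if)
  finally show False using three_big by simp
qed

text \<open>Three small vertices inscribed in the triangle \<open>w, y, z\<close>; the vertices opposite to \<open>w\<close>, \<open>y\<close>, \<open>z\<close>
  are \<open>v\<close>, \<open>x\<close>, \<open>u\<close>.\<close>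

definition small_triangle :: "complex \<Rightarrow> complex \<Rightarrow> complex \<Rightarrow> complex \<Rightarrow> complex \<Rightarrow> complex \<Rightarrow> bool" where
  "small_triangle u v x w y z \<longleftrightarrow> u \<in> small \<and> v \<in> small \<and> x \<in> small \<and>
     link4 u v x w y \<and> link4 v u x z y \<and> link4 x u v z w"

text \<open>These two transpositions generate all permutations of the inner vertices, with the outer
  ones moved accordingly; later it is enough to treat one big vertex or one distribution.\<close>

lemma small_triangle_swap:
  "small_triangle u v x w y z \<Longrightarrow> small_triangle u x v y w z"
  "small_triangle u v x w y z \<Longrightarrow> small_triangle v u x z y w"
  unfolding small_triangle_def by (meson link4_reverse link4_rotate)+

text \<open>An inner edge lies in the inner triangle and in one further facial triangle, so the
  links of its two ends share that apex. This identifies the six outer vertices of the three links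
  in pairs.\<close>

lemma small_triangle_exists:
  assumes s: "u \<in> small" "v \<in> small" "x \<in> small" and t: "tr u v x"
  obtains w y z where "small_triangle u v x w y z"
proof -
  obtain w y where u: "link4 u v x w y" using link4_exists[OF s(1) t] by blast
  have "tr v u x" using t tr_commute by blast
  then obtain z y' where v: "link4 v u x z y'" using link4_exists[OF s(2)] by blast
  have "tr v u y" using link4D(6)[OF u] tr_commute by blast
  then have y: "y' = y" using link4_tr_snd[OF v] link4D(1)[OF u] by auto
  have "tr x u v" using t tr_commute by blast
  then obtain c d where x: "link4 x u v c d" using link4_exists[OF s(3)] by blast
  have "tr x u w" using link4D(4)[OF u] tr_commute by blast
  then have "d = w" using link4_tr_snd[OF x] link4D(1)[OF u] by auto
  moreover have "tr x v z" using link4D(4)[OF v] tr_commute by blast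
  then have "z = c \<or> z = u" using link4_tr_snd[OF link4_rotate[OF x]] by auto
  then have "c = z" using link4D(1)[OF v] by auto
  ultimately show thesis using that u v x y s unfolding small_triangle_def by blast
qed

text \<open>Otherwise the octahedron on these six vertices is the whole graph.\<close>

lemma small_triangle_big:
  assumes t: "small_triangle u v x w y z"
  shows "y \<in> B"
proof (rule ccontr)
  assume nB: "y \<notin> B"
  have s: "u \<in> small" "v \<in> small" "x \<in> small" and u: "link4 u v x w y" and v: "link4 v u x z y"
    and x: "link4 x u v z w" using t unfolding small_triangle_def by auto
  have du: "distinct [u, v, x, w, y]" and dv: "distinct [v, u, x, z, y]" and dx: "distinct [x, u, v, z, w]"
    using link4D(1)[OF u] link4D(1)[OF v] link4D(1)[OF x] by blast+
  have "y \<in> nbrs u" using link4D(2)[OF u] by auto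
  then have sy: "y \<in> small" using nbrs_verts nB by (auto simp: small_def)
  have "tr y u v" using link4D(6)[OF u] tr_commute by blast
  then obtain c d where y: "link4 y u v c d" using link4_exists[OF sy] by blast
  have "tr y u w" using link4D(5)[OF u] tr_commute by blast
  then have "d = w" using link4_tr_snd[OF y] du by auto
  moreover have "tr y v z" using link4D(5)[OF v] tr_commute by blast
  then have "c = z" using link4_tr_snd[OF link4_rotate[OF y]] dv by auto
  ultimately have y: "link4 y u v z w" using y by simp
  \<comment> \<open>Now the link of \<open>y\<close> is closed too, so these four small vertices
    have only \<open>w\<close> and \<open>z\<close> as further neighbours. The frontier of their
    star lies in the arc of \<open>{w, z}\<close>, and an arc does not separate the plane.\<close>
  let ?C = "{u, v, x, y}"
  have nb: "nbrs s \<subseteq> ?C \<union> {w, z}" if "s \<in> ?C" for s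
    using that link4D(2)[OF u] link4D(2)[OF v] link4D(2)[OF x] link4D(2)[OF y] by auto
  have wz: "{w, z} \<in> edges G" using tr_edges(2)[OF link4D(5)[OF x]] by (simp add: insert_commute)
  have "verts G \<subseteq> ?C \<union> arc_of {w, z}"
  proof (rule region_fills)
    show "?C \<subseteq> verts G" using s sy by (auto simp: small_def)
    show "connected (- arc_of {w, z})"
      using connected_arc_complement[OF arc_curve[OF wz]] by simp
    show "frontier (region ?C) \<subseteq> arc_of {w, z}"
    proof
      fix q assume "q \<in> frontier (region ?C)"
      then obtain s p r where q: "s \<in> ?C" "tr s p r" "cell q \<subseteq> {p, r}" "cell q \<inter> ?C = {}"
        by (rule frontier_region_triangle)
      have "{p, r} \<subseteq> ?C \<union> {w, z}" using nb[OF q(1)] tr_nbrs[OF q(2)] by auto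
      then have "cell q \<subseteq> {w, z}" using q(3,4) by blast
      then show "q \<in> arc_of {w, z}" using arc_of_iff_cell[OF wz] by blast
    qed
    have "{w, z} \<inter> ?C = {}" using du dv dx by auto
    then show "region ?C \<inter> arc_of {w, z} = {}"
      using arc_of_iff_cell[OF wz] unfolding region_def by blast
  qed auto
  then have "B \<subseteq> {w, z}"
    using arc_of_verts[OF wz] B_verts s sy unfolding small_def by blast
  then show False by (rule big_not_within_two)
qed

lemma small_triangle_bigs:
  assumes t: "small_triangle u v x w y z"
  shows "w \<in> B" "y \<in> B" "z \<in> B"
  using small_triangle_big small_triangle_swap t by blast+

lemma small_triangle_edges:
  assumes t: "small_triangle u v x w y z"
  shows "{w, y} \<in> edges G" "{y, z} \<in> edges G" "{z, w} \<in> edges G" "distinct [w, y, z]"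
proof -
  have u: "link4 u v x w y" and v: "link4 v u x z y" and x: "link4 x u v z w"
    using t unfolding small_triangle_def by auto
  show "{w, y} \<in> edges G" "{y, z} \<in> edges G" "{z, w} \<in> edges G"
    using tr_edges(2)[OF link4D(5)[OF u]] tr_edges(2)[OF link4D(5)[OF v]]
      tr_edges(2)[OF link4D(5)[OF x]] by (simp_all add: insert_commute)
  show "distinct [w, y, z]" using link4D(1)[OF u] link4D(1)[OF v] link4D(1)[OF x] by auto
qed

text \<open>For the frontier an inclusion is enough: three edges cannot carry a facial
  4-cycle.\<close>

lemma small_triangle_region:
  assumes t: "small_triangle u v x w y z"
  shows "region {u, v, x} \<in> faces (induced G B)"
    "frontier (region {u, v, x}) \<subseteq> carrier_of {{w, y}, {y, z}, {z, w}}"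
proof -
  have s: "u \<in> small" "v \<in> small" "x \<in> small" and u: "link4 u v x w y" and v: "link4 v u x z y"
    and x: "link4 x u v z w" using t unfolding small_triangle_def by auto
  have e: "{u, v} \<in> edges G" "{v, x} \<in> edges G" using tr_edges[OF link4D(3)[OF u]] by blast+
  have "region (set [u, v, x]) \<in> faces (induced G B)"
    using s e link4D(2)[OF u] link4D(2)[OF v] link4D(2)[OF x] small_triangle_bigs[OF t]
    by (intro region_face_nbrs) auto
  then show "region {u, v, x} \<in> faces (induced G B)" by simp
  show "frontier (region {u, v, x}) \<subseteq> carrier_of {{w, y}, {y, z}, {z, w}}"
  proof
    fix q assume "q \<in> frontier (region {u, v, x})"
    then obtain s p r where q: "s \<in> {u, v, x}" "tr s p r" "cell q \<subseteq> {p, r}" "cell q \<inter> {u, v, x} = {}"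
      by (rule frontier_region_triangle)
    from q(1) have "cell q \<subseteq> {w, y} \<or> cell q \<subseteq> {y, z} \<or> cell q \<subseteq> {z, w}"
    proof (elim insertE)
      assume "s = u"
      then have "{p, r} = {v, x} \<or> {p, r} = {x, w} \<or> {p, r} = {w, y} \<or> {p, r} = {y, v}"
        using link4_tr[OF u] q(2) by simp
      then have "cell q \<subseteq> {v, x} \<or> cell q \<subseteq> {x, w} \<or> cell q \<subseteq> {w, y} \<or> cell q \<subseteq> {y, v}"
        using q(3) by metis
      then show ?thesis using q(4) by blast
    next
      assume "s = v"
      then have "{p, r} = {u, x} \<or> {p, r} = {x, z} \<or> {p, r} = {z, y} \<or> {p, r} = {y, u}"
        using link4_tr[OF v] q(2) by simp
      then have "cell q \<subseteq> {u, x} \<or> cell q \<subseteq> {x, z} \<or> cell q \<subseteq> {z, y} \<or> cell q \<subseteq> {y, u}"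
        using q(3) by metis
      then show ?thesis using q(4) by blast
    next
      assume "s = x"
      then have "{p, r} = {u, v} \<or> {p, r} = {v, z} \<or> {p, r} = {z, w} \<or> {p, r} = {w, u}"
        using link4_tr[OF x] q(2) by simp
      then have "cell q \<subseteq> {u, v} \<or> cell q \<subseteq> {v, z} \<or> cell q \<subseteq> {z, w} \<or> cell q \<subseteq> {w, u}"
        using q(3) by metis
      then show ?thesis using q(4) by blast
    qed auto
    then show "q \<in> carrier_of {{w, y}, {y, z}, {z, w}}"
      using small_triangle_edges[OF t] arc_of_iff_cell by auto
  qed
qed

end

section \<open>Paths of small vertices\<close>

context eulerian_triangulation
begin

lemma small_not_big: "u \<in> small \<Longrightarrow> u \<notin> B"
  by (simp add: small_def)

lemma link4_opposite:
  assumes l: "link4 u a x b y" and s: "s \<in> nbrs u" "s \<noteq> x" "s \<noteq> y"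
  obtains t where "link4 u s x t y"
proof -
  have "s = a \<or> s = b" using link4D(2)[OF l] s by auto
  moreover have "link4 u b x a y" using l link4_reverse link4_rotate by metis
  ultimately show thesis using that l by blast
qed

lemma link4_opposite_eq:
  "link4 u s x t y \<Longrightarrow> r \<in> nbrs u \<Longrightarrow> r \<noteq> x \<Longrightarrow> r \<noteq> y \<Longrightarrow> r \<noteq> s \<Longrightarrow> r = t"
  by (drule link4D(2)) auto

lemma cell_subset_singleton:
  assumes "cell q \<subseteq> {v}"
  shows "q = v"
proof (cases q rule: cell_cases)
  case (edge e)
  then show ?thesis using assms edge_card[of e] card_mono[of "{v}" e] by auto
next
  case (face F)
  then show ?thesis using assms card_corners[of F] card_mono[of "{v}" "corners F"] by auto
qed (use assms in auto)

text \<open>Frontier cells contain no vertex of \<open>C\<close>, so in each link only the poles and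
  vertices of \<open>W\<close> remain. \<open>W\<close> will be empty for a closed chain, a single
  vertex for coinciding ends, and the pair of big ends of a bead.\<close>

lemma frontier_region_links:
  assumes l: "\<And>s. s \<in> C \<Longrightarrow> \<exists>c d. c \<in> C \<union> W \<and> d \<in> C \<union> W \<and> link4 s c x d y"
    and q: "q \<in> frontier (region C)"
  shows "cell q \<subseteq> {x} \<or> cell q \<subseteq> {y} \<or> (\<exists>c\<in>W. cell q \<subseteq> {c, x} \<or> cell q \<subseteq> {c, y})"
proof -
  obtain s p r where q: "s \<in> C" "tr s p r" "cell q \<subseteq> {p, r}" "cell q \<inter> C = {}"
    using q by (rule frontier_region_triangle)
  obtain c d where cd: "c \<in> C \<union> W" "d \<in> C \<union> W" "link4 s c x d y" using l[OF q(1)] by blast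
  have "{p, r} = {c, x} \<or> {p, r} = {d, x} \<or> {p, r} = {d, y} \<or> {p, r} = {c, y}"
    using link4_tr[OF cd(3)] q(2) by (simp add: insert_commute)
  then have "cell q \<subseteq> {c, x} \<or> cell q \<subseteq> {d, x} \<or> cell q \<subseteq> {d, y} \<or> cell q \<subseteq> {c, y}"
    using q(3) by metis
  then have "\<exists>c\<in>C \<union> W. cell q \<subseteq> {c, x} \<or> cell q \<subseteq> {c, y}"
    using cd(1,2) by blast
  then obtain c' where c': "c' \<in> C \<union> W" "cell q \<subseteq> {c', x} \<or> cell q \<subseteq> {c', y}" by blast
  show ?thesis
  proof (cases "c' \<in> W")
    case False
    then have "c' \<notin> cell q" using c'(1) q(4) by blast
    then show ?thesis using c'(2) by blast
  qed (use c' in blast)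
qed

text \<open>A bead under construction: the poles are opposite in every link, but the ends are still
  free. Counting from 1 reserves the indices 0 and \<open>Suc n\<close> for the big ends.\<close>

definition chain :: "complex \<Rightarrow> complex \<Rightarrow> nat \<Rightarrow> (nat \<Rightarrow> complex) \<Rightarrow> bool" where
  "chain x y n p \<longleftrightarrow> inj_on p {1..n} \<and> p ` {1..n} \<subseteq> small \<and>
     (\<forall>i\<in>{1..n}. \<exists>a b. link4 (p i) a x b y) \<and>
     (\<forall>i. 1 \<le> i \<and> i < n \<longrightarrow> p (Suc i) \<in> nbrs (p i))"

lemma chain_step: "chain x y n p \<Longrightarrow> 1 \<le> i \<Longrightarrow> i < n \<Longrightarrow> p (Suc i) \<in> nbrs (p i)"
  by (simp add: chain_def)

lemma chain_inj:
  "chain x y n p \<Longrightarrow> 1 \<le> i \<Longrightarrow> i \<le> n \<Longrightarrow> 1 \<le> j \<Longrightarrow> j \<le> n \<Longrightarrow> p i = p j \<longleftrightarrow> i = j"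
  unfolding chain_def by (intro inj_on_eq_iff[of p "{1..n}"]) auto

lemma chain_small: "chain x y n p \<Longrightarrow> 1 \<le> i \<Longrightarrow> i \<le> n \<Longrightarrow> p i \<in> small"
  by (auto simp: chain_def)

text \<open>Besides the poles a link has two opposite vertices. The predecessor is one of them, and
  by injectivity the successor, if any, is the other.\<close>

lemma chain_link:
  assumes c: "chain x y n p" and xy: "x \<in> B" "y \<in> B" and i: "1 < i" "i \<le> n"
  obtains t where "link4 (p i) (p (i - 1)) x t y" "i < n \<Longrightarrow> t = p (Suc i)"
proof -
  have sm: "p j \<in> small" if "1 \<le> j" "j \<le> n" for j
    using chain_small[OF c that] .
  have np: "p j \<noteq> x" "p j \<noteq> y" if "1 \<le> j" "j \<le> n" for j
    using sm[OF that] small_not_big xy by metis+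
  have "i \<in> {1..n}" using i by simp
  then obtain a b where ab: "link4 (p i) a x b y" using c unfolding chain_def by blast
  have i': "1 \<le> i - 1" "i - 1 \<le> n" "i - 1 < n" "Suc (i - 1) = i" using i by auto
  then have "p (i - 1) \<in> nbrs (p i)" using chain_step[OF c, of "i - 1"] nbrs_sym by simp
  then obtain t where t: "link4 (p i) (p (i - 1)) x t y"
    using link4_opposite[OF ab] np[OF i'(1,2)] by blast
  have "t = p (Suc i)" if "i < n"
  proof -
    have "p (Suc i) \<in> nbrs (p i)" using chain_step[OF c] i that by simp
    moreover have "p (Suc i) \<noteq> p (i - 1)"
      using chain_inj[OF c, of "Suc i" "i - 1"] i' that by auto
    ultimately show ?thesis using link4_opposite_eq[OF t] np[of "Suc i"] that by auto
  qed
  then show thesis using that t by blast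
qed

text \<open>Allows the analysis of the last vertex to be reused for the first.\<close>

lemma chain_reverse:
  assumes c: "chain x y n p"
  shows "chain x y n (\<lambda>i. p (Suc n - i))"
proof -
  have im: "(\<lambda>i. Suc n - i) ` {1..n} = {1..n}"
  proof -
    have "j \<in> (\<lambda>i. Suc n - i) ` {1..n}" if "j \<in> {1..n}" for j
      using that by (intro image_eqI[of _ _ "Suc n - j"]) auto
    then show ?thesis by auto
  qed
  have "inj_on (p \<circ> (\<lambda>i. Suc n - i)) {1..n}"
  proof (rule comp_inj_on)
    show "inj_on (\<lambda>i. Suc n - i) {1..n}" by (rule inj_onI) auto
    show "inj_on p ((\<lambda>i. Suc n - i) ` {1..n})" using c im by (simp add: chain_def)
  qed
  moreover have "(\<lambda>i. p (Suc n - i)) ` {1..n} = p ` {1..n}"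
    using im by (metis image_image)
  moreover have "p (Suc n - Suc i) \<in> nbrs (p (Suc n - i))" if "1 \<le> i" "i < n" for i
  proof -
    have "p (Suc (n - i)) \<in> nbrs (p (n - i))" using chain_step[OF c, of "n - i"] that by simp
    moreover have "Suc n - i = Suc (n - i)" "Suc n - Suc i = n - i" using that by auto
    ultimately show ?thesis using nbrs_sym by simp
  qed
  moreover have "\<exists>a b. link4 (p (Suc n - i)) a x b y" if "i \<in> {1..n}" for i
  proof -
    have "Suc n - i \<in> {1..n}" using that by auto
    then show ?thesis using c unfolding chain_def by blast
  qed
  ultimately show ?thesis using c unfolding chain_def by (simp add: comp_def)
qed

text \<open>If a longest chain closes up, then the graph is a double wheel with poles \<open>x\<close> and \<open>y\<close>.\<close>

lemma longest_chain_end: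
  assumes c: "chain x y n p" and xy: "x \<in> B" "y \<in> B" and n: "1 \<le> n"
    and max: "\<And>m q. chain x y m q \<Longrightarrow> v \<in> q ` {1..m} \<Longrightarrow> m \<le> n" and v: "v \<in> p ` {1..n}"
    and l: "link4 (p n) s x w y" and s: "2 \<le> n \<Longrightarrow> s = p (n - 1)"
  shows "w \<in> B"
proof (rule ccontr)
  assume nB: "w \<notin> B"
  let ?C = "p ` {1..n}"
  have sm: "p j \<in> small" if "1 \<le> j" "j \<le> n" for j
    using chain_small[OF c that] .
  have np: "p j \<noteq> x" "p j \<noteq> y" if "1 \<le> j" "j \<le> n" for j
    using sm[OF that] small_not_big xy by metis+
  have inj: "p i = p j \<longleftrightarrow> i = j" if "1 \<le> i" "i \<le> n" "1 \<le> j" "j \<le> n" for i j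
    using chain_inj[OF c that] .
  have dl: "distinct [p n, s, x, w, y]" using link4D(1)[OF l] .
  have wn: "w \<in> nbrs (p n)" using link4D(2)[OF l] by auto
  then have ws: "w \<in> small" using nbrs_verts nB by (auto simp: small_def)
  \<comment> \<open>Otherwise the chain can be prolonged by \<open>w\<close>: the edge from
    \<open>p n\<close> to \<open>w\<close> has the apexes \<open>x\<close> and \<open>y\<close>, so
    these are opposite in the link of \<open>w\<close> as well.\<close>
  have "w \<in> ?C"
  proof (rule ccontr)
    assume wC: "w \<notin> ?C"
    have "tr w (p n) x" using link4D(4)[OF l] tr_commute by blast
    then obtain r t where rt: "link4 w (p n) x r t" using link4_exists[OF ws] by blast
    have "tr w (p n) y" using link4D(5)[OF l] tr_commute by blast
    then have "t = y" using link4_tr_snd[OF rt] dl by auto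
    then have lw: "link4 w (p n) x r y" using rt by simp
    let ?q = "p(Suc n := w)"
    have S: "{1..Suc n} = insert (Suc n) {1..n}" by auto
    have eq: "?q i = p i" if "i \<in> {1..n}" for i using that by auto
    have "inj_on ?q {1..Suc n}"
    proof -
      have "inj_on ?q {1..n}" using c eq inj_on_cong[of "{1..n}" ?q p] unfolding chain_def by blast
      moreover have "?q ` {1..n} = ?C" using eq by (intro image_cong) auto
      ultimately show ?thesis using wC unfolding S by (simp add: inj_on_insert)
    qed
    moreover have "?q ` {1..Suc n} \<subseteq> small" using ws sm by auto
    moreover have "\<exists>a b. link4 (?q i) a x b y" if "i \<in> {1..Suc n}" for i
    proof (cases "i = Suc n")
      case True
      then show ?thesis using lw by auto
    next
      case False
      then show ?thesis using c that unfolding chain_def by auto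
    qed
    moreover have "?q (Suc i) \<in> nbrs (?q i)" if "1 \<le> i \<and> i < Suc n" for i
    proof (cases "i = n")
      case True
      then show ?thesis using wn by simp
    next
      case False
      then show ?thesis using c that unfolding chain_def by auto
    qed
    ultimately have "chain x y (Suc n) ?q" unfolding chain_def by blast
    moreover have "v \<in> ?q ` {1..Suc n}" using v by fastforce
    ultimately show False using max by fastforce
  qed
  then obtain j where j: "1 \<le> j" "j \<le> n" "w = p j" by auto
  have "j \<noteq> n" using j dl by auto
  then have n2: "2 \<le> n" using j by simp
  have "j \<noteq> n - 1" using j dl s[OF n2] by auto
  then have jn: "Suc j < n" using j \<open>j \<noteq> n\<close> by simp
  have nj: "p n \<in> nbrs (p j)" using wn j nbrs_sym by blast
  \<comment> \<open>At an inner vertex both neighbours other than the poles are adjacent members of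
    the chain, which leaves no place for \<open>p n\<close>.\<close>
  have j1: "j = 1"
  proof (rule ccontr)
    assume "j \<noteq> 1"
    then have j2: "1 < j" using j by simp
    obtain t where t: "link4 (p j) (p (j - 1)) x t y" "t = p (Suc j)"
      using chain_link[OF c xy j2 j(2)] jn by (metis Suc_lessD)
    have "p n \<noteq> p (j - 1)" using inj[of n "j - 1"] j2 jn by simp
    then have "p n = p (Suc j)" using link4_opposite_eq[OF t(1) nj] np[of n] n t(2) by simp
    then show False using inj[of n "Suc j"] jn by simp
  qed
  \<comment> \<open>In the closed chain no link has an outer vertex besides the poles. Hence the
    frontier shrinks to the two points \<open>x\<close> and \<open>y\<close>, whose complement is
    connected.\<close>
  have links: "\<exists>c d. c \<in> ?C \<union> {} \<and> d \<in> ?C \<union> {} \<and> link4 s c x d y" if sC: "s \<in> ?C" for s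
  proof -
    obtain i where i: "1 \<le> i" "i \<le> n" "s = p i" using sC by auto
    consider "i = 1" | "1 < i" "i < n" | "i = n" using i by linarith
    then show ?thesis
    proof cases
      case 1
      obtain a b where ab: "link4 (p 1) a x b y" using c n unfolding chain_def by fastforce
      have "p 2 \<in> nbrs (p 1)"
        using chain_step[OF c, of 1] n2 jn j1 by (simp add: numeral_2_eq_2)
      then obtain t where t: "link4 (p 1) (p 2) x t y" using link4_opposite[OF ab] np[of 2] n2 by auto
      have "p n = t" using link4_opposite_eq[OF t] nj j1 np[of n] inj[of n 2] jn n by auto
      moreover have "2 \<in> {1..n}" "n \<in> {1..n}" using n2 by auto
      ultimately show ?thesis using t i(3) 1 by blast
    next
      case 2
      then obtain t where "link4 (p i) (p (i - 1)) x t y" "t = p (Suc i)"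
        using chain_link[OF c xy 2(1)] i by metis
      moreover have "i - 1 \<in> {1..n}" "Suc i \<in> {1..n}" using 2 by auto
      ultimately show ?thesis using i(3) by blast
    next
      case 3
      have "n - 1 \<in> {1..n}" "j \<in> {1..n}" using n2 j by auto
      then show ?thesis using l s[OF n2] i(3) 3 j(3) by blast
    qed
  qed
  have CB: "?C \<inter> B = {}" using sm small_not_big by auto
  have "verts G \<subseteq> ?C \<union> {x, y}"
  proof (rule region_fills)
    show "?C \<subseteq> verts G" using sm by (auto simp: small_def)
    show "?C \<noteq> {}" using n by auto
    show "connected (- {x, y})"
      using path_connected_complement_countable[of "{x, y}"] path_connected_imp_connected by simp
    show "frontier (region ?C) \<subseteq> {x, y}"
      using frontier_region_links[OF links] cell_subset_singleton by blast
    have "x \<notin> ?C" "y \<notin> ?C" "x \<in> verts G" "y \<in> verts G"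
      using CB xy B_verts by blast+
    then show "region ?C \<inter> {x, y} = {}" by (auto simp: region_def cell_vertex)
  qed
  then have "B \<subseteq> {x, y}" using B_verts CB by blast
  then show False by (rule big_not_within_two)
qed

text \<open>The path \<open>p 1, \<dots>, p n\<close> of small vertices has the big ends \<open>p 0\<close>, \<open>p (Suc n)\<close> and the big
  poles \<open>x\<close>, \<open>y\<close>.\<close>

definition bead :: "complex \<Rightarrow> complex \<Rightarrow> nat \<Rightarrow> (nat \<Rightarrow> complex) \<Rightarrow> bool" where
  "bead x y n p \<longleftrightarrow> x \<in> B \<and> y \<in> B \<and> 1 \<le> n \<and> inj_on p {1..n} \<and> p ` {1..n} \<subseteq> small \<and>
     p 0 \<in> B \<and> p (Suc n) \<in> B \<and> p 0 \<noteq> p (Suc n) \<and>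
     (\<forall>i\<in>{1..n}. link4 (p i) (p (i - 1)) x (p (Suc i)) y)"

text \<open>The poles come from the link of \<open>v\<close>, and then a longest chain through
  \<open>v\<close> with these poles is taken. Such a chain exists since its length is bounded by the
  number of vertices, and maximality makes both ends big.\<close>

lemma bead_exists:
  assumes v: "v \<in> small" and no_tr: "\<And>a b. a \<in> small \<Longrightarrow> b \<in> small \<Longrightarrow> \<not> tr v a b"
  obtains x y n p where "bead x y n p" "v \<in> p ` {1..n}"
proof -
  have smallI: "a \<in> B" if "a \<in> nbrs v" "a \<notin> small" for a
    using that nbrs_verts by (auto simp: small_def)
  \<comment> \<open>If \<open>v\<close> has a small neighbour \<open>a\<close>, then by
    \<open>no_tr\<close> both apexes of the edge from \<open>v\<close> to \<open>a\<close> are big,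
    and they are opposite in the link. If not, all neighbours are big and any opposite pair will
    do.\<close>
  have "\<exists>a x b y. link4 v a x b y \<and> x \<in> B \<and> y \<in> B"
  proof (cases "\<exists>a. a \<in> nbrs v \<and> a \<in> small")
    case True
    then obtain a where a: "a \<in> nbrs v" "a \<in> small" by blast
    obtain x where "tr v a x"
      using edge_two_triangles[of v a] a(1) unfolding nbrs_def by (metis mem_Collect_eq)
    then obtain b y where l: "link4 v a x b y" using link4_exists[OF v] by blast
    have "\<not> x \<in> small" using no_tr[OF a(2)] link4D(3)[OF l] by blast
    moreover have "tr v a y" using link4D(6)[OF l] tr_commute by blast
    then have "\<not> y \<in> small" using no_tr[OF a(2)] by blast
    moreover have "x \<in> nbrs v" "y \<in> nbrs v" using link4D(2)[OF l] by auto
    ultimately show ?thesis using l smallI by blast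
  next
    case False
    obtain a x where "tr v a x" using vertex_triangle[of v] v by (auto simp: small_def)
    then obtain b y where l: "link4 v a x b y" using link4_exists[OF v] by blast
    then have "x \<in> nbrs v" "y \<in> nbrs v" using link4D(2)[OF l] by auto
    then show ?thesis using l smallI False by blast
  qed
  then obtain a x b y where vl: "link4 v a x b y" and xy: "x \<in> B" "y \<in> B" by blast
  let ?P = "\<lambda>(n, p). chain x y n p \<and> v \<in> p ` {1..n}"
  have "?P (1, \<lambda>_. v)" using v vl unfolding chain_def by auto
  moreover have "fst np < card (verts G) + 1" if P: "?P np" for np
  proof -
    obtain n p where np: "np = (n, p)" by force
    then have "inj_on p {1..n}" "p ` {1..n} \<subseteq> verts G"
      using P unfolding chain_def small_def by auto
    then have "card {1..n} \<le> card (verts G)" using card_inj_on_le finite_verts by blast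
    then show ?thesis using np by simp
  qed
  ultimately have "\<exists>np. ?P np \<and> (\<forall>mq. ?P mq \<longrightarrow> fst mq \<le> fst np)"
    by (intro ex_has_greatest_nat[where b = "card (verts G) + 1"]) blast+
  then obtain np where np: "?P np" "\<And>mq. ?P mq \<Longrightarrow> fst mq \<le> fst np" by blast
  define n p where "n = fst np" and "p = snd np"
  have c: "chain x y n p" and vp: "v \<in> p ` {1..n}"
    using np(1) unfolding n_def p_def by (auto simp: case_prod_beta)
  have max: "m \<le> n" if "chain x y m q" "v \<in> q ` {1..m}" for m q
    using np(2)[of "(m, q)"] that unfolding n_def by simp
  let ?C = "p ` {1..n}"
  have n: "1 \<le> n" using vp by auto
  have sm: "p j \<in> small" if "1 \<le> j" "j \<le> n" for j
    using chain_small[OF c that] .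
  have np: "p j \<noteq> x" "p j \<noteq> y" if "1 \<le> j" "j \<le> n" for j
    using sm[OF that] small_not_big xy by metis+
  have inj: "p i = p j \<longleftrightarrow> i = j" if "1 \<le> i" "i \<le> n" "1 \<le> j" "j \<le> n" for i j
    using chain_inj[OF c that] .
  have "\<exists>s w. link4 (p n) s x w y \<and> (2 \<le> n \<longrightarrow> s = p (n - 1))"
  proof (cases "2 \<le> n")
    case True
    then show ?thesis using chain_link[OF c xy, of n] by (metis Suc_1 Suc_le_lessD le_refl)
  next
    case False
    then show ?thesis using c n unfolding chain_def by fastforce
  qed
  then obtain s w where l: "link4 (p n) s x w y" and s: "2 \<le> n \<Longrightarrow> s = p (n - 1)" by blast
  have wB: "w \<in> B" using longest_chain_end[OF c xy n max vp l s] .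
  \<comment> \<open>Here \<open>t\<close> is the neighbour on the side of the chain and
    \<open>z\<close> the end sought. A chain of length 1 has both ends in the same link, so there
    \<open>t\<close> has to be the end \<open>w\<close> already found.\<close>
  have "\<exists>t z. link4 (p 1) t x z y \<and> (2 \<le> n \<longrightarrow> t = p 2) \<and> (n = 1 \<longrightarrow> t = w)"
  proof (cases "2 \<le> n")
    case True
    obtain a b where ab: "link4 (p 1) a x b y" using c n unfolding chain_def by fastforce
    have "p 2 \<in> nbrs (p 1)"
      using chain_step[OF c, of 1] True by (simp add: numeral_2_eq_2)
    then obtain z where "link4 (p 1) (p 2) x z y" using link4_opposite[OF ab] np[of 2] True by auto
    then show ?thesis using True by auto
  next
    case False
    then have "n = 1" using n by simp
    then have "link4 (p 1) w x s y" using l link4_reverse link4_rotate by metis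
    then show ?thesis using \<open>n = 1\<close> by auto
  qed
  then obtain t z where lz: "link4 (p 1) t x z y" and t: "2 \<le> n \<Longrightarrow> t = p 2" "n = 1 \<Longrightarrow> t = w"
    by blast
  have "v \<in> (\<lambda>i. p (Suc n - i)) ` {1..n}"
  proof -
    obtain i where "i \<in> {1..n}" "v = p i" using vp by blast
    then show ?thesis by (intro image_eqI[of _ _ "Suc n - i"]) auto
  qed
  then have vr: "v \<in> (\<lambda>i. p (Suc n - i)) ` {1..n}" .
  have zB: "z \<in> B"
  proof (rule longest_chain_end[OF chain_reverse[OF c] xy n _ vr])
    show "m \<le> n" if "chain x y m q" "v \<in> q ` {1..m}" for m q using max that .
    show "link4 (p (Suc n - n)) t x z y" using lz by simp
    have "Suc n - (n - 1) = 2" using n by simp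
    then show "2 \<le> n \<Longrightarrow> t = p (Suc n - (n - 1))" using t(1) by simp
  qed
  \<comment> \<open>A chain says nothing about its values outside \<open>1..n\<close>; they are set
    to the big ends.\<close>
  define p' where "p' = p(0 := z, Suc n := w)"
  have p'p: "p' i = p i" if "1 \<le> i" "i \<le> n" for i using that by (auto simp: p'_def)
  have p'0: "p' 0 = z" "p' (Suc n) = w" by (auto simp: p'_def)
  have links: "link4 (p' i) (p' (i - 1)) x (p' (Suc i)) y" if i: "1 \<le> i" "i \<le> n" for i
  proof -
    consider "i = 1" "n = 1" | "i = 1" "2 \<le> n" | "1 < i" "i < n" | "1 < i" "i = n" using i by linarith
    then show ?thesis
    proof cases
      case 1
      have "link4 (p 1) z x w y" using lz t(2) 1 link4_reverse link4_rotate by metis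
      then show ?thesis using 1 p'0 p'p by auto
    next
      case 2
      have "link4 (p 1) z x (p 2) y" using lz t(1) 2 link4_reverse link4_rotate by metis
      then show ?thesis using 2 p'0 p'p by (simp add: numeral_2_eq_2)
    next
      case 3
      then obtain t where "link4 (p i) (p (i - 1)) x t y" "t = p (Suc i)"
        using chain_link[OF c xy] i by metis
      then show ?thesis using 3 p'p by simp
    next
      case 4
      then show ?thesis using l s p'p p'0 by simp
    qed
  qed
  have im: "p' ` {1..n} = ?C" using p'p by (intro image_cong) auto
  have dz: "distinct [p 1, t, x, z, y]" and dw: "distinct [p n, s, x, w, y]"
    using link4D(1)[OF lz] link4D(1)[OF l] .
  \<comment> \<open>With coinciding ends the frontier lies in the arc \<open>x, w, y\<close>, so all
    big vertices are among these three. This does not yet contradict \<open>three_big\<close>; the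
    contradiction is that \<open>w\<close> then has degree at most 4.\<close>
  have "w \<noteq> z"
  proof
    assume wz: "w = z"
    then have n2: "2 \<le> n" using t(2) dz n by (cases "n = 1") auto
    have links': "\<exists>c d. c \<in> ?C \<union> {w} \<and> d \<in> ?C \<union> {w} \<and> link4 s c x d y" if sC: "s \<in> ?C" for s
    proof -
      obtain i where i: "1 \<le> i" "i \<le> n" "s = p i" using sC by auto
      have "p' j \<in> ?C \<union> {w}" if "j \<le> Suc n" for j
      proof (cases "j = 0 \<or> j = Suc n")
        case False
        then have "1 \<le> j" "j \<le> n" using that by auto
        then show ?thesis using p'p by auto
      qed (use p'0 wz in auto)
      then have "p' (i - 1) \<in> ?C \<union> {w}" "p' (Suc i) \<in> ?C \<union> {w}" using i by auto
      then show ?thesis using links[OF i(1,2)] p'p[OF i(1,2)] i(3) by metis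
    qed
    have e: "{x, w} \<in> edges G" "{w, y} \<in> edges G"
      using tr_edges(2)[OF link4D(4)[OF l]] tr_edges(2)[OF link4D(5)[OF l]] by blast+
    then have pe: "path_edges [x, w, y] \<subseteq> edges G" by simp
    let ?X = "carrier_of (path_edges [x, w, y])"
    have X: "?X \<inter> verts G = {x, w, y}"
      using carrier_path_edges_Int_verts[OF pe] by simp
    have "verts G \<subseteq> ?C \<union> ?X"
    proof (rule region_fills)
      show "?C \<subseteq> verts G" using sm by (auto simp: small_def)
      show "?C \<noteq> {}" using n by auto
      have "distinct [x, w, y]" using dw by auto
      then obtain g where "arc g" "path_image g = ?X" using path_arc[of "[x, w, y]"] pe by auto
      then show "connected (- ?X)" using connected_arc_complement[of g] by simp
      show "frontier (region ?C) \<subseteq> ?X"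
      proof
        fix q assume "q \<in> frontier (region ?C)"
        then have "cell q \<subseteq> {x, w} \<or> cell q \<subseteq> {w, y}"
          using frontier_region_links[OF links'] by blast
        then show "q \<in> ?X" using arc_of_iff_cell e by auto
      qed
      have "?C \<inter> B = {}" using sm small_not_big by auto
      then have "{x, w, y} \<inter> ?C = {}" using xy wB by blast
      then show "region ?C \<inter> ?X = {}" using arc_of_iff_cell e by (fastforce simp: region_def)
    qed
    then have V: "verts G \<subseteq> ?C \<union> {x, w, y}" using X by blast
    have "nbrs w \<subseteq> {p 1, p n, x, y}"
    proof
      fix r assume r: "r \<in> nbrs w"
      have "r \<noteq> w" using r not_self_nbr by blast
      then have "r \<in> ?C \<or> r = x \<or> r = y" using r nbrs_verts V by blast
      moreover have "r \<in> {p 1, p n}" if rC: "r \<in> ?C"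
      proof -
        obtain i where i: "1 \<le> i" "i \<le> n" "r = p i" using rC by auto
        have "i = 1 \<or> i = n"
        proof (rule ccontr)
          assume "\<not> (i = 1 \<or> i = n)"
          then have i': "1 < i" "i < n" using i by auto
          then have "nbrs (p i) = {p (i - 1), x, p (Suc i), y}"
            using link4D(2)[OF links[OF i(1,2)]] p'p by simp
          moreover have "w \<in> nbrs (p i)" using r i(3) nbrs_sym by blast
          moreover have "1 \<le> i - 1" "i - 1 \<le> n" using i' by auto
          then have "w \<noteq> p (i - 1)" "w \<noteq> p (Suc i)"
            using sm[of "i - 1"] sm[of "Suc i"] i' wB by (auto simp: small_def)
          ultimately show False using dw i' p'p by auto
        qed
        then show ?thesis using i by auto
      qed
      ultimately show "r \<in> {p 1, p n, x, y}" by blast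
    qed
    then have "card (nbrs w) \<le> card {p 1, p n, x, y}" by (intro card_mono) auto
    also have "\<dots> \<le> 4" by (simp add: card_insert_if)
    finally show False using wB degree_nbrs[of w] by (simp add: big_verts_def)
  qed
  moreover have "inj_on p' {1..n}" using c p'p inj_on_cong[of "{1..n}" p' p] unfolding chain_def by auto
  moreover have "p' ` {1..n} \<subseteq> small" using im sm by auto
  ultimately have "bead x y n p'"
    using xy n zB wB p'0 links unfolding bead_def by auto
  then show thesis using that vp im by metis
qed

lemma beadD:
  assumes "bead x y n p"
  shows "x \<in> B" "y \<in> B" "1 \<le> n" "inj_on p {1..n}" "p 0 \<in> B" "p (Suc n) \<in> B" "p 0 \<noteq> p (Suc n)"
    "\<And>i. 1 \<le> i \<Longrightarrow> i \<le> n \<Longrightarrow> p i \<in> small"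
    "\<And>i. 1 \<le> i \<Longrightarrow> i \<le> n \<Longrightarrow> link4 (p i) (p (i - 1)) x (p (Suc i)) y"
  using assms unfolding bead_def by (auto simp: image_subset_iff)

text \<open>The range includes \<open>i = 0\<close>, where the triangles are read off in the link of
  \<open>p 1\<close>; thus the edges to both big ends are covered.\<close>

lemma bead_tr:
  assumes b: "bead x y n p" and i: "i \<le> n"
  shows "tr (p i) (p (Suc i)) x" "tr (p i) (p (Suc i)) y"
proof -
  have "tr (p i) (p (Suc i)) x \<and> tr (p i) (p (Suc i)) y"
  proof (cases "i = 0")
    case True
    then have l: "link4 (p 1) (p 0) x (p 2) y"
      using beadD(9)[OF b, of 1] beadD(3)[OF b] by (simp add: numeral_2_eq_2)
    show ?thesis using link4D(3)[OF l] link4D(6)[OF l] True tr_commute by (metis One_nat_def)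
  next
    case False
    then have l: "link4 (p i) (p (i - 1)) x (p (Suc i)) y" using beadD(9)[OF b] i by simp
    show ?thesis using link4D(4)[OF l] link4D(5)[OF l] tr_commute by metis
  qed
  then show "tr (p i) (p (Suc i)) x" "tr (p i) (p (Suc i)) y" by auto
qed

lemma bead_boundary:
  assumes b: "bead x y n p"
  shows "{p 0, x} \<in> edges G" "{x, p (Suc n)} \<in> edges G" "{p (Suc n), y} \<in> edges G"
    "{y, p 0} \<in> edges G" "distinct [p 0, x, p (Suc n), y]"
proof -
  note n = beadD(3)[OF b]
  show e: "{p 0, x} \<in> edges G" "{x, p (Suc n)} \<in> edges G" "{p (Suc n), y} \<in> edges G"
    "{y, p 0} \<in> edges G"
    using tr_edges(3)[OF bead_tr(1)[OF b, of 0]] tr_edges(2)[OF bead_tr(1)[OF b, of n]]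
      tr_edges(2)[OF bead_tr(2)[OF b, of n]] tr_edges(3)[OF bead_tr(2)[OF b, of 0]] n
    by (simp_all add: insert_commute)
  have "x \<noteq> y" using link4D(1)[OF beadD(9)[OF b, of 1]] n by auto
  then show "distinct [p 0, x, p (Suc n), y]"
    using e[THEN edge_neq] beadD(7)[OF b] by auto
qed

text \<open>Equality of the frontier is required here, as \<open>bounded_by_cycle\<close> compares
  the whole boundary. The links bound it from above, the triangles at \<open>p 1\<close> and
  \<open>p n\<close> from below.\<close>

lemma bead_region:
  assumes b: "bead x y n p"
  shows "region (p ` {1..n}) \<in> faces (induced G B)"
    "frontier (region (p ` {1..n})) =
      carrier_of {{p 0, x}, {x, p (Suc n)}, {p (Suc n), y}, {y, p 0}}"
proof -
  let ?C = "p ` {1..n}"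
  note n = beadD(3)[OF b]
  note bd = bead_boundary[OF b]
  let ?vs = "map p [1..<Suc n]"
  have sv: "set ?vs = ?C" by (simp add: atLeastLessThanSuc_atLeastAtMost del: upt_Suc)
  have pC: "p i \<in> ?C \<union> {p 0, p (Suc n)}" if "i \<le> Suc n" for i
    using that by (cases "i = 0 \<or> i = Suc n") auto
  have links: "\<exists>c d. c \<in> ?C \<union> {p 0, p (Suc n)} \<and> d \<in> ?C \<union> {p 0, p (Suc n)} \<and> link4 s c x d y"
    if sC: "s \<in> ?C" for s
  proof -
    obtain i where i: "1 \<le> i" "i \<le> n" "s = p i" using sC by auto
    have "p (i - 1) \<in> ?C \<union> {p 0, p (Suc n)}" "p (Suc i) \<in> ?C \<union> {p 0, p (Suc n)}"
      using pC i by auto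
    then show ?thesis using beadD(9)[OF b i(1,2)] i(3) by blast
  qed
  have "region (set ?vs) \<in> faces (induced G B)"
  proof (rule region_face_nbrs)
    show "?vs \<noteq> []" using n by simp
    show "set ?vs \<subseteq> small" unfolding sv using beadD(8)[OF b] by auto
    have "{p (Suc i), p (Suc (Suc i))} \<in> edges G" if "Suc i < n" for i
      using tr_edges(1)[OF bead_tr(1)[OF b, of "Suc i"]] that by simp
    then show "successively (\<lambda>a b. {a, b} \<in> edges G) ?vs"
      unfolding successively_conv_nth by (simp del: upt_Suc)
    show "nbrs s \<subseteq> set ?vs \<union> B" if "s \<in> set ?vs" for s
    proof -
      obtain c d where "c \<in> ?C \<union> {p 0, p (Suc n)}" "d \<in> ?C \<union> {p 0, p (Suc n)}" "link4 s c x d y"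
        using links \<open>s \<in> set ?vs\<close> unfolding sv by blast
      then show ?thesis unfolding sv using link4D(2)[of s c x d y] beadD(1,2,5,6)[OF b] by auto
    qed
  qed
  then show "region ?C \<in> faces (induced G B)" unfolding sv .
  show "frontier (region ?C) = carrier_of {{p 0, x}, {x, p (Suc n)}, {p (Suc n), y}, {y, p 0}}"
    (is "_ = ?K")
  proof
    show "frontier (region ?C) \<subseteq> ?K"
    proof
      fix q assume "q \<in> frontier (region ?C)"
      then have "cell q \<subseteq> {p 0, x} \<or> cell q \<subseteq> {x, p (Suc n)} \<or> cell q \<subseteq> {p (Suc n), y} \<or> cell q \<subseteq> {y, p 0}"
        using frontier_region_links[OF links] by blast
      then show "q \<in> ?K" using arc_of_iff_cell bd by auto
    qed
    show "?K \<subseteq> frontier (region ?C)"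
    proof
      fix q assume "q \<in> ?K"
      then have q: "cell q \<subseteq> {p 0, x} \<or> cell q \<subseteq> {x, p (Suc n)} \<or> cell q \<subseteq> {p (Suc n), y} \<or> cell q \<subseteq> {y, p 0}"
        using arc_of_iff_cell bd by auto
      have "?C \<inter> B = {}" using beadD(8)[OF b] small_not_big by auto
      then have "{p 0, x, p (Suc n), y} \<inter> ?C = {}" using beadD(1,2,5,6)[OF b] by blast
      then have disj: "cell q \<inter> ?C = {}" using q by blast
      \<comment> \<open>Each of the four boundary edges is opposite to \<open>p 1\<close> or to
        \<open>p n\<close> in a facial triangle.\<close>
      have "\<exists>s r t. s \<in> ?C \<and> tr s r t \<and> cell q \<subseteq> {s, r, t}"
      proof -
        have "tr (p 1) (p 0) x" "tr (p 1) (p 0) y" "p 1 \<in> ?C" "p n \<in> ?C"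
          "tr (p n) (p (Suc n)) x" "tr (p n) (p (Suc n)) y"
          using bead_tr[OF b, of 0] bead_tr[OF b, of n] n tr_commute by (auto simp: tr_commute)
        then show ?thesis using q by blast
      qed
      then obtain s r t where s: "s \<in> ?C" "tr s r t" "cell q \<subseteq> {s, r, t}" by blast
      then obtain F where "F \<in> faces G" "corners F = {s, r, t}"
        unfolding facial_triangle_def by blast
      then show "q \<in> frontier (region ?C)"
        unfolding frontier_region using disj s by blast
    qed
  qed
qed

lemma small_component_cases:
  assumes "v \<in> small"
  obtains (triangle) a b w y z where "small_triangle v a b w y z"
  | (bead) x y n p where "bead x y n p" "v \<in> p ` {1..n}"
proof (cases "\<exists>a b. a \<in> small \<and> b \<in> small \<and> tr v a b")
  case True
  then show thesis using small_triangle_exists assms triangle by metis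
next
  case False
  then show thesis using bead_exists[OF assms] bead by metis
qed

end

section \<open>Extending forests\<close>

lemma forest_induced:
  "forest (induced G X) \<longleftrightarrow> (\<forall>c. is_cycle G c \<longrightarrow> \<not> set c \<subseteq> X)"
  unfolding forest_def is_cycle_induced by blast

lemma forest_induced_subset: "forest (induced G X) \<Longrightarrow> Y \<subseteq> X \<Longrightarrow> forest (induced G Y)"
  unfolding forest_induced by blast

lemma induced_induced: "induced (induced G X) Y = induced G (X \<inter> Y)"
  unfolding induced_def by auto

lemma same_part_two:
  assumes "L1 \<inter> L2 = {}" "u \<in> L1 \<union> L2" "v \<in> L1 \<union> L2"
  shows "same_part {L1, L2} u v \<longleftrightarrow> (u \<in> L1 \<longleftrightarrow> v \<in> L1)"
    "distinct_parts {L1, L2} u v \<longleftrightarrow> (u \<in> L1 \<longleftrightarrow> v \<notin> L1)"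
  using assms unfolding same_part_def distinct_parts_def by auto

text \<open>A numerical colouring. Points outside all classes also get the value 2, so that every
  value is below 3.\<close>

definition class_of :: "'a set \<Rightarrow> 'a set \<Rightarrow> 'a \<Rightarrow> nat" where
  "class_of V1 V2 v = (if v \<in> V1 then 0 else if v \<in> V2 then 1 else 2)"

text \<open>Empty intersections may coincide as sets, so distinctness of parts needs care: the parts
  concerned are inhabited, and \<open>u\<close> tells them apart.\<close>

lemma same_part_three:
  assumes "three_partition X V1 V2 V3" "Y \<subseteq> X" "u \<in> Y" "v \<in> Y"
  shows "same_part {Y \<inter> V1, Y \<inter> V2, Y \<inter> V3} u v \<longleftrightarrow> class_of V1 V2 u = class_of V1 V2 v"
    "distinct_parts {Y \<inter> V1, Y \<inter> V2, Y \<inter> V3} u v \<longleftrightarrow> class_of V1 V2 u \<noteq> class_of V1 V2 v"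
proof -
  have u: "u \<in> V1 \<or> u \<in> V2 \<or> u \<in> V3" and v: "v \<in> V1 \<or> v \<in> V2 \<or> v \<in> V3"
    using assms unfolding three_partition_def by auto
  have d: "V1 \<inter> V2 = {}" "V1 \<inter> V3 = {}" "V2 \<inter> V3 = {}"
    using assms unfolding three_partition_def by auto
  let ?V = "{V1, V2, V3}"
  have J: "{Y \<inter> V1, Y \<inter> V2, Y \<inter> V3} = (\<inter>) Y ` ?V" by simp
  have disj: "P = Q" if "P \<in> ?V" "Q \<in> ?V" "r \<in> P" "r \<in> Q" for P Q r
    using that d by blast
  have cl: "class_of V1 V2 u = class_of V1 V2 v \<longleftrightarrow> (\<exists>P\<in>?V. u \<in> P \<and> v \<in> P)"
    using u v d unfolding class_of_def by auto
  show "same_part {Y \<inter> V1, Y \<inter> V2, Y \<inter> V3} u v \<longleftrightarrow> class_of V1 V2 u = class_of V1 V2 v"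
    unfolding cl J same_part_def using assms(3,4) by auto
  have "distinct_parts ((\<inter>) Y ` ?V) u v" if "\<not> (\<exists>P\<in>?V. u \<in> P \<and> v \<in> P)"
  proof -
    obtain P Q where PQ: "P \<in> ?V" "Q \<in> ?V" "u \<in> P" "v \<in> Q" using u v by blast
    then have "u \<notin> Q" using that by blast
    then have "Y \<inter> P \<noteq> Y \<inter> Q" using PQ assms(3) by blast
    then show ?thesis unfolding distinct_parts_def using PQ assms(3,4) by (metis IntI imageI)
  qed
  moreover have "\<not> (\<exists>P\<in>?V. u \<in> P \<and> v \<in> P)" if dp: "distinct_parts ((\<inter>) Y ` ?V) u v"
  proof
    assume "\<exists>P\<in>?V. u \<in> P \<and> v \<in> P"
    then obtain R where R: "R \<in> ?V" "u \<in> R" "v \<in> R" by blast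
    obtain X' Z' where XZ: "X' \<in> (\<inter>) Y ` ?V" "Z' \<in> (\<inter>) Y ` ?V" "X' \<noteq> Z'" "u \<in> X'" "v \<in> Z'"
      using dp unfolding distinct_parts_def by (elim bexE conjE) (rule that)
    obtain P where P: "P \<in> ?V" "X' = Y \<inter> P" using XZ(1) by (elim imageE)
    obtain Q where Q: "Q \<in> ?V" "Z' = Y \<inter> Q" using XZ(2) by (elim imageE)
    have "P = R" "Q = R" using disj[OF P(1) R(1), of u] disj[OF Q(1) R(1), of v] P(2) Q(2) XZ(4,5) R(2,3) by simp_all
    then show False using P(2) Q(2) XZ(3) by simp
  qed
  ultimately show "distinct_parts {Y \<inter> V1, Y \<inter> V2, Y \<inter> V3} u v \<longleftrightarrow> class_of V1 V2 u \<noteq> class_of V1 V2 v"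
    unfolding cl J by blast
qed

lemma interval_propagate:
  fixes n :: nat
  assumes "\<And>i. a \<le> i \<Longrightarrow> i < n \<Longrightarrow> R i \<longleftrightarrow> R (Suc i)" and "R j" "a \<le> j" "j \<le> n" and "a \<le> i" "i \<le> n"
  shows "R i"
proof -
  have "R k \<longleftrightarrow> R a" if "a \<le> k" "k \<le> n" for k
    using that
  proof (induction k rule: dec_induct)
    case (step k)
    then show ?case using assms(1)[of k] by simp
  qed simp
  then show ?thesis using assms(2-) by blast
qed

section \<open>Adding one group of small vertices to a pair of forests\<close>

context eulerian_triangulation
begin

lemma cycle_two_nbrs:
  assumes "is_cycle G c" "u \<in> set c"
  obtains a b where "a \<noteq> b" "a \<in> set c" "b \<in> set c" "a \<in> nbrs u" "b \<in> nbrs u"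
  using cycle_neighbours[OF assms] unfolding nbrs_def by (metis mem_Collect_eq)

text \<open>The standard way below to show that new vertices create no cycle: each has at most one
  neighbour available to the cycle.\<close>

lemma cycle_one_nbr:
  assumes "is_cycle G c" "u \<in> set c" "nbrs u \<inter> set c \<subseteq> {a}"
  shows False
  using cycle_two_nbrs[OF assms(1,2)] assms(3) by (metis IntI singletonD subsetD)

lemma triangle_cycle:
  assumes "{a, b} \<in> edges G" "{b, c} \<in> edges G" "{c, a} \<in> edges G"
  shows "is_cycle G [a, b, c]"
  using assms[THEN edge_neq] assms[THEN edge_verts] assms
  unfolding is_cycle_Cons by (auto simp: insert_commute)

lemma not_mono_triangle:
  assumes "forest (induced G X)" "{a, b} \<in> edges G" "{b, c} \<in> edges G" "{c, a} \<in> edges G"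
  shows "\<not> {a, b, c} \<subseteq> X"
  using triangle_cycle[OF assms(2-4)] assms(1) unfolding forest_induced by force

text \<open>One step of the extension: \<open>S\<close> and \<open>T\<close> are the parts built so
  far, and \<open>C\<close> is a whole group of small vertices to be distributed.\<close>

definition extendable :: "complex set \<Rightarrow> complex set \<Rightarrow> complex set \<Rightarrow> bool" where
  "extendable S T C \<longleftrightarrow>
     (\<exists>X\<subseteq>C. forest (induced G (S \<union> X)) \<and> forest (induced G (T \<union> (C - X))))"

lemma extendable_swap:
  assumes "extendable S T C"
  shows "extendable T S C"
proof -
  obtain X where X: "X \<subseteq> C" "forest (induced G (S \<union> X))" "forest (induced G (T \<union> (C - X)))"
    using assms unfolding extendable_def by blast
  moreover have "C - (C - X) = X" using X by blast
  ultimately show ?thesis unfolding extendable_def by (intro exI[of _ "C - X"]) auto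
qed

text \<open>With \<open>w\<close> alone on its side, \<open>u\<close> and \<open>v\<close> hang on
  \<open>S\<close> as a pendant path starting at \<open>w\<close>, and \<open>x\<close> hangs on
  \<open>T\<close> as a pendant vertex at \<open>z\<close>.\<close>

lemma small_triangle_extendable_1:
  assumes t: "small_triangle u v x w y z"
    and f: "forest (induced G S)" "forest (induced G T)"
    and d: "S \<inter> T = {}" "(S \<union> T) \<inter> {u, v, x} = {}" and m: "w \<in> S" "y \<in> T" "z \<in> T"
  shows "extendable S T {u, v, x}"
proof -
  have u: "link4 u v x w y" and v: "link4 v u x z y" and x: "link4 x u v z w"
    using t unfolding small_triangle_def by auto
  have du: "distinct [u, v, x, w, y]" and dv: "distinct [v, u, x, z, y]" and dx: "distinct [x, u, v, z, w]"
    using link4D(1)[OF u] link4D(1)[OF v] link4D(1)[OF x] by blast+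
  note nu = link4D(2)[OF u] and nv = link4D(2)[OF v] and nx = link4D(2)[OF x]
  have "forest (induced G (S \<union> {u, v}))"
    unfolding forest_induced
  proof (intro allI impI notI)
    fix c assume c: "is_cycle G c" "set c \<subseteq> S \<union> {u, v}"
    have "v \<notin> set c"
    proof
      assume "v \<in> set c"
      moreover have "nbrs v \<inter> set c \<subseteq> {u}" using nv c(2) d m dv by auto
      ultimately show False using cycle_one_nbr c(1) by blast
    qed
    moreover have "u \<notin> set c"
    proof
      assume "u \<in> set c"
      moreover have "nbrs u \<inter> set c \<subseteq> {w}" using nu c(2) d m du \<open>v \<notin> set c\<close> by auto
      ultimately show False using cycle_one_nbr c(1) by blast
    qed
    ultimately have "set c \<subseteq> S" using c(2) by auto
    then show False using f(1) c(1) unfolding forest_induced by blast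
  qed
  moreover have "forest (induced G (T \<union> {x}))"
    unfolding forest_induced
  proof (intro allI impI notI)
    fix c assume c: "is_cycle G c" "set c \<subseteq> T \<union> {x}"
    have "x \<notin> set c"
    proof
      assume "x \<in> set c"
      moreover have "nbrs x \<inter> set c \<subseteq> {z}" using nx c(2) d m dx by auto
      ultimately show False using cycle_one_nbr c(1) by blast
    qed
    then have "set c \<subseteq> T" using c(2) by auto
    then show False using f(2) c(1) unfolding forest_induced by blast
  qed
  moreover have "{u, v, x} - {u, v} = {x}" using du by auto
  ultimately show ?thesis unfolding extendable_def by (intro exI[of _ "{u, v}"]) auto
qed

text \<open>The three big vertices form a triangle, so they cannot all be in one forest. One of them
  is alone on its side, and symmetry reduces to the case above.\<close>

lemma small_triangle_extendable:
  assumes t: "small_triangle u v x w y z"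
    and f: "forest (induced G S)" "forest (induced G T)"
    and d: "S \<inter> T = {}" "(S \<union> T) \<inter> {u, v, x} = {}" and m: "{w, y, z} \<subseteq> S \<union> T"
  shows "extendable S T {u, v, x}"
proof -
  have t2: "small_triangle u x v y w z" "small_triangle v u x z y w"
    using small_triangle_swap t by blast+
  have p: "{u, x, v} = {u, v, x}" "{v, u, x} = {u, v, x}" by auto
  have one: "extendable S T {u, v, x}"
    if f: "forest (induced G S)" "forest (induced G T)" and d: "S \<inter> T = {}" "(S \<union> T) \<inter> {u, v, x} = {}"
      and m: "w \<in> S \<and> y \<in> T \<and> z \<in> T \<or> y \<in> S \<and> w \<in> T \<and> z \<in> T \<or> z \<in> S \<and> y \<in> T \<and> w \<in> T" for S T
    using m
  proof (elim disjE conjE)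
    assume "w \<in> S" "y \<in> T" "z \<in> T"
    then show ?thesis using small_triangle_extendable_1[OF t f d] by blast
  next
    assume "y \<in> S" "w \<in> T" "z \<in> T"
    then show ?thesis using small_triangle_extendable_1[OF t2(1) f d(1)] d(2) unfolding p by blast
  next
    assume "z \<in> S" "y \<in> T" "w \<in> T"
    then show ?thesis using small_triangle_extendable_1[OF t2(2) f d(1)] d(2) unfolding p by blast
  qed
  note e = small_triangle_edges(1-3)[OF t]
  have "\<not> {w, y, z} \<subseteq> S" "\<not> {w, y, z} \<subseteq> T" using not_mono_triangle f e by blast+
  then consider
    "w \<in> S \<and> y \<in> T \<and> z \<in> T \<or> y \<in> S \<and> w \<in> T \<and> z \<in> T \<or> z \<in> S \<and> y \<in> T \<and> w \<in> T"
    | "w \<in> T \<and> y \<in> S \<and> z \<in> S \<or> y \<in> T \<and> w \<in> S \<and> z \<in> S \<or> z \<in> T \<and> y \<in> S \<and> w \<in> S"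
    using m by auto
  then show ?thesis
  proof cases
    case 1
    then show ?thesis using one f d by blast
  next
    case 2
    have "T \<inter> S = {}" "(T \<union> S) \<inter> {u, v, x} = {}" using d by auto
    then show ?thesis using one[OF f(2,1)] 2 extendable_swap by blast
  qed
qed

definition proper_col :: "(complex \<Rightarrow> nat) \<Rightarrow> bool" where
  "proper_col col \<longleftrightarrow> (\<forall>u v. {u, v} \<in> edges G \<longrightarrow> col u \<noteq> col v) \<and> (\<forall>v. col v < 3)"

lemma third_colour:
  "(i::nat) < 3 \<Longrightarrow> j < 3 \<Longrightarrow> k < 3 \<Longrightarrow> l < 3 \<Longrightarrow> i \<noteq> j \<Longrightarrow> j \<noteq> k \<Longrightarrow> k \<noteq> i \<Longrightarrow>
    l \<noteq> i \<Longrightarrow> l \<noteq> j \<Longrightarrow> l = k"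
  by linarith

text \<open>Each edge of the path forms triangles with both poles, so both poles have the third
  colour, and the path alternates between the other two.\<close>

lemma bead_colours:
  assumes b: "bead x y n p" and c: "proper_col col"
  shows "col x = col y"
    "\<And>i. i \<le> n \<Longrightarrow> col (p (Suc i)) = col (p 0) \<longleftrightarrow> col (p i) \<noteq> col (p 0)"
proof -
  have ne: "col u \<noteq> col v" if "{u, v} \<in> edges G" for u v
    using c that unfolding proper_col_def by blast
  have lt: "col v < 3" for v using c unfolding proper_col_def by blast
  have tc: "col (p i) \<noteq> col (p (Suc i))" "col (p (Suc i)) \<noteq> col x" "col x \<noteq> col (p i)"
    "col y \<noteq> col (p i)" "col y \<noteq> col (p (Suc i))" if "i \<le> n" for i
    using tr_edges(1-3)[OF bead_tr(1)[OF b that], THEN ne]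
      tr_edges(2,3)[OF bead_tr(2)[OF b that], THEN ne] by metis+
  show "col x = col y"
    using third_colour[OF lt lt lt lt tc(1-5)[of 0]] by simp
  fix i assume i: "i \<le> n"
  have "col (p 0) \<noteq> col x" using tc(3)[of 0] by simp
  then show "col (p (Suc i)) = col (p 0) \<longleftrightarrow> col (p i) \<noteq> col (p 0)"
    using tc(1-3)[OF i] third_colour[OF lt lt lt lt, of "p i" "p (Suc i)" x "p 0"]
      third_colour[OF lt lt lt lt, of "p i" x "p (Suc i)" "p 0"] by metis
qed

lemma bead_nbrs:
  assumes b: "bead x y n p" and i: "1 \<le> i" "i \<le> n"
  shows "nbrs (p i) = {p (i - 1), x, p (Suc i), y}"
  using link4D(2)[OF beadD(9)[OF b i]] .

text \<open>Membership is made to alternate with the colour. A new vertex then has both path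
  neighbours in the other part and only one pole in its own, so no cycle passes through it.\<close>

lemma bead_extendable_opposite:
  assumes b: "bead x y n p"
    and f: "forest (induced G S)" "forest (induced G T)"
    and d: "S \<inter> T = {}" "(S \<union> T) \<inter> p ` {1..n} = {}"
    and m: "x \<in> S" "y \<in> T" "p 0 \<in> S \<union> T" "p (Suc n) \<in> S \<union> T"
    and c: "proper_col col"
    and e: "(p 0 \<in> S \<longleftrightarrow> p (Suc n) \<in> S) \<longleftrightarrow> col (p 0) = col (p (Suc n))"
  shows "extendable S T (p ` {1..n})"
proof -
  let ?C = "p ` {1..n}"
  define X where "X = {u \<in> ?C. col u = col (p 0) \<longleftrightarrow> p 0 \<in> S}"
  have XC: "X \<subseteq> ?C" by (auto simp: X_def)
  have big: "p 0 \<notin> ?C" "p (Suc n) \<notin> ?C" "x \<notin> ?C" "y \<notin> ?C"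
    using d(2) m by blast+
  \<comment> \<open>One rule for all of \<open>0..Suc n\<close>. It is anchored at
    \<open>p 0\<close>; at the other big end it is the hypothesis \<open>e\<close>.\<close>
  have mem: "p i \<in> S \<union> X \<longleftrightarrow> (col (p i) = col (p 0) \<longleftrightarrow> p 0 \<in> S)" if "i \<le> Suc n" for i
  proof -
    have "i = 0 \<or> i = Suc n \<or> i \<in> {1..n}" using that by auto
    then consider "i = 0" | "i = Suc n" | "i \<in> {1..n}" by blast
    then show ?thesis
    proof cases
      case 1
      then show ?thesis using big XC by auto
    next
      case 2
      then have "p i \<notin> X" using big XC by auto
      then show ?thesis using e 2 by auto
    next
      case 3
      then have "p i \<notin> S" using d(2) by blast
      then show ?thesis using 3 by (auto simp: X_def)
    qed
  qed
  have alt: "p (Suc i) \<in> S \<union> X \<longleftrightarrow> p i \<notin> S \<union> X" if "i \<le> n" for i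
    using mem[of i] mem[of "Suc i"] bead_colours(2)[OF b c that] that by auto
  have memT: "p i \<in> T \<union> (?C - X) \<longleftrightarrow> p i \<notin> S \<union> X" if "i \<le> Suc n" for i
  proof -
    have "p i \<in> S \<union> T \<union> ?C"
      using m(3,4) that by (cases "i = 0 \<or> i = Suc n") auto
    then show ?thesis using XC d by blast
  qed
  have near: "i - 1 \<le> n" "Suc (i - 1) = i" if "i \<in> {1..n}" for i using that by auto
  have "forest (induced G (S \<union> X))"
    unfolding forest_induced
  proof (intro allI impI notI)
    fix c assume c: "is_cycle G c" "set c \<subseteq> S \<union> X"
    have "u \<notin> set c" if "u \<in> X" for u
    proof
      assume u: "u \<in> set c"
      obtain i where i: "i \<in> {1..n}" "u = p i" using \<open>u \<in> X\<close> XC by blast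
      have "p i \<in> S \<union> X" using u i c by blast
      then have "p (i - 1) \<notin> set c" "p (Suc i) \<notin> set c"
        using alt[of i] alt[OF near(1)[OF i(1)]] near(2)[OF i(1)] i(1) c(2) by auto
      moreover have "y \<notin> set c" using c(2) m(2) d(1) big XC by blast
      ultimately have "nbrs u \<inter> set c \<subseteq> {x}" using bead_nbrs[OF b] i by auto
      then show False using cycle_one_nbr c(1) u by blast
    qed
    then have "set c \<subseteq> S" using c(2) by auto
    then show False using f(1) c(1) unfolding forest_induced by blast
  qed
  moreover have "forest (induced G (T \<union> (?C - X)))"
    unfolding forest_induced
  proof (intro allI impI notI)
    fix c assume c: "is_cycle G c" "set c \<subseteq> T \<union> (?C - X)"
    have "u \<notin> set c" if "u \<in> ?C" for u
    proof
      assume u: "u \<in> set c"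
      obtain i where i: "i \<in> {1..n}" "u = p i" using \<open>u \<in> ?C\<close> by blast
      have "p i \<in> T \<union> (?C - X)" using u i c by blast
      then have "p i \<notin> S \<union> X" using memT[of i] i(1) by simp
      then have "p (i - 1) \<in> S \<union> X" "p (Suc i) \<in> S \<union> X"
        using alt[of i] alt[OF near(1)[OF i(1)]] near(2)[OF i(1)] i(1) by auto
      moreover have "i - 1 \<le> Suc n" "Suc i \<le> Suc n" using i(1) by auto
      ultimately have "p (i - 1) \<notin> set c" "p (Suc i) \<notin> set c"
        using memT[of "i - 1"] memT[of "Suc i"] c(2) by blast+
      moreover have "x \<notin> set c" using c(2) m(1) d(1) big by blast
      ultimately have "nbrs u \<inter> set c \<subseteq> {y}" using bead_nbrs[OF b] i by auto
      then show False using cycle_one_nbr c(1) u by blast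
    qed
    then have "set c \<subseteq> T" using c(2) by auto
    then show False using f(2) c(1) unfolding forest_induced by blast
  qed
  ultimately show ?thesis unfolding extendable_def using XC by blast
qed

text \<open>Without the poles a path vertex has just two neighbours left, so a cycle using it must
  use both; this propagates to the two big ends.\<close>

lemma bead_cycle_through:
  assumes b: "bead x y n p" and c: "is_cycle G c" "x \<notin> set c" "y \<notin> set c"
    and i: "i \<in> {1..n}" "p i \<in> set c" and j: "j \<le> Suc n"
  shows "p j \<in> set c"
proof -
  have both: "p (k - 1) \<in> set c \<and> p (Suc k) \<in> set c" if k: "1 \<le> k" "k \<le> n" "p k \<in> set c" for k
  proof -
    obtain r s where rs: "r \<noteq> s" "r \<in> set c" "s \<in> set c" "r \<in> nbrs (p k)" "s \<in> nbrs (p k)"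
      using cycle_two_nbrs[OF c(1) k(3)] by metis
    have "r \<in> {p (k - 1), p (Suc k)}" "s \<in> {p (k - 1), p (Suc k)}"
      using rs c(2,3) bead_nbrs[OF b k(1,2)] by auto
    then show ?thesis using rs(1-3) by auto
  qed
  have step: "p k \<in> set c \<longleftrightarrow> p (Suc k) \<in> set c" if "1 \<le> k" "k < n" for k
    using both[of k] both[of "Suc k"] that by auto
  have all: "p k \<in> set c" if "1 \<le> k" "k \<le> n" for k
    by (rule interval_propagate[where a = 1 and n = n and R = "\<lambda>k. p k \<in> set c" and j = i])
      (use step i that in auto)
  have n: "1 \<le> n" using i by simp
  show ?thesis
    using all[of j] both[of 1] both[of n] all[of 1] all[of n] n j
    by (cases "j = 0 \<or> j = Suc n") auto
qed

text \<open>Every cycle in \<open>T\<close> plus the path contains the whole path, so withdrawing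
  one vertex from that side destroys them all. The vertex withdrawn is \<open>p 1\<close>; its
  neighbours on such a cycle are \<open>p 0\<close> and \<open>p 2\<close>, where \<open>p 2\<close>
  is a big end if \<open>n = 1\<close>.\<close>

lemma bead_extendable_same:
  assumes b: "bead x y n p"
    and f: "forest (induced G S)" "forest (induced G T)"
    and d: "S \<inter> T = {}" "(S \<union> T) \<inter> p ` {1..n} = {}"
    and m: "x \<in> S" "y \<in> S"
  shows "extendable S T (p ` {1..n})"
proof (cases "forest (induced G (T \<union> p ` {1..n}))")
  case True
  then show ?thesis unfolding extendable_def using f(1) by (intro exI[of _ "{}"]) auto
next
  case False
  let ?C = "p ` {1..n}"
  have n: "1 \<le> n" "1 \<in> {1..n}" using beadD(3)[OF b] by auto
  have xy: "x \<notin> T \<union> ?C" "y \<notin> T \<union> ?C" using m d by blast+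
  have meets: "\<exists>i\<in>{1..n}. p i \<in> set c" if c: "is_cycle G c" "set c \<subseteq> T \<union> ?C" for c
  proof (rule ccontr)
    assume "\<not> ?thesis"
    then have "set c \<subseteq> T" using c(2) by auto
    then show False using f(2) c(1) unfolding forest_induced by blast
  qed
  have thr: "p j \<in> set c" if c: "is_cycle G c" "set c \<subseteq> T \<union> ?C" and j: "j \<le> Suc n" for c j
  proof -
    obtain i where "i \<in> {1..n}" "p i \<in> set c" using meets[OF c] by blast
    then show ?thesis using bead_cycle_through[OF b c(1)] xy c(2) j by blast
  qed
  obtain c where c: "is_cycle G c" "set c \<subseteq> T \<union> ?C"
    using False unfolding forest_induced by blast
  have "p 1 \<in> set c" using thr[OF c, of 1] by simp
  then obtain qs where qs: "is_cycle G (p 1 # qs)" "set (p 1 # qs) = set c"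
    using is_cycle_rotate[OF c(1)] by metis
  have nb1: "nbrs (p 1) = {p 0, x, p 2, y}" using bead_nbrs[OF b, of 1] n by (simp add: numeral_2_eq_2)
  have q: "2 \<le> length qs" "distinct (p 1 # qs)" "hd qs \<in> nbrs (p 1)" "last qs \<in> nbrs (p 1)"
    using qs(1) unfolding is_cycle_Cons nbrs_def by auto
  have qne: "qs \<noteq> []" using q by auto
  have "hd qs \<noteq> last qs" using q(1,2) by (cases qs) (auto simp: last_conv_nth split: if_splits)
  moreover have qsT: "set qs \<subseteq> T \<union> ?C" using c(2) unfolding qs(2)[symmetric] by simp
  then have "hd qs \<in> T \<union> ?C" "last qs \<in> T \<union> ?C" using qne by (meson hd_in_set last_in_set subsetD)+
  then have "hd qs \<in> {p 0, p 2}" "last qs \<in> {p 0, p 2}"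
    using q(3,4) xy unfolding nb1 by (metis insert_iff)+
  ultimately have ends: "{hd qs, last qs} = {p 0, p 2}" by auto
  have dS: "S \<inter> (T \<union> ?C) = {}" using d by (simp add: Int_Un_distrib Int_Un_distrib2)
  have q02: "p 0 \<in> set qs" "p 2 \<in> set qs"
    using hd_in_set[OF qne] last_in_set[OF qne] ends by (auto simp: doubleton_eq_iff)
  have p02: "p 0 \<notin> S \<union> {p 1}" "p 2 \<notin> S \<union> {p 1}"
    using q02 q(2) qsT dS by auto
  have "forest (induced G (S \<union> {p 1}))"
    unfolding forest_induced
  proof (intro allI impI notI)
    fix c' assume c': "is_cycle G c'" "set c' \<subseteq> S \<union> {p 1}"
    have "p 1 \<in> set c'"
    proof (rule ccontr)
      assume "p 1 \<notin> set c'"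
      then have "set c' \<subseteq> S" using c'(2) by auto
      then show False using f(1) c'(1) unfolding forest_induced by blast
    qed
    then obtain ps where ps: "is_cycle G (p 1 # ps)" "set (p 1 # ps) = set c'"
      using is_cycle_rotate[OF c'(1)] by metis
    have P: "ps \<noteq> []" "distinct (p 1 # ps)" "hd ps \<in> nbrs (p 1)"
      using ps(1) unfolding is_cycle_Cons nbrs_def by auto
    have psS: "set (p 1 # ps) \<subseteq> S \<union> {p 1}" using c'(2) unfolding ps(2) .
    then have "hd ps \<in> S \<union> {p 1}" using hd_in_set[OF P(1)] by auto
    then have "hd ps = x \<or> hd ps = y" using P(3) nb1 p02 by auto
    moreover have l: "link4 (p 1) (p 0) x (p 2) y"
      using beadD(9)[OF b, of 1] n by (simp add: numeral_2_eq_2)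
    then have "r = p 0 \<or> r = p 2" if "tr (p 1) x r" for r
      using link4_tr_snd[OF link4_rotate[OF l]] that by auto
    moreover have "r = p 0 \<or> r = p 2" if "tr (p 1) y r" for r
      using link4_tr_snd[OF link4_rotate[OF link4_rotate[OF link4_rotate[OF l]]]] that by auto
    moreover have "set ps \<inter> set qs = {}"
    proof -
      have "set ps \<subseteq> S" using psS P(2) by auto
      then show ?thesis using qsT dS by fast
    qed
    \<comment> \<open>One cycle leaves \<open>p 1\<close> through a pole, the other through
      \<open>p 0\<close> and \<open>p 2\<close>. These alternate in the link, so the edge to the
      pole has the apexes \<open>p 0\<close> and \<open>p 2\<close>, and the cycles share only
      \<open>p 1\<close>.\<close>
    ultimately show False using cycles_cross[OF ps(1) qs(1) _ refl ends] by blast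
  qed
  moreover have "forest (induced G (T \<union> (?C - {p 1})))"
    unfolding forest_induced
  proof (intro allI impI notI)
    fix c' assume c': "is_cycle G c'" "set c' \<subseteq> T \<union> (?C - {p 1})"
    then have "p 1 \<in> set c'" using thr[of c' 1] n by auto
    then have "p 1 \<in> T" using c'(2) by auto
    then show False using d(2) n by blast
  qed
  ultimately show ?thesis unfolding extendable_def using n(2) by (intro exI[of _ "{p 1}"]) auto
qed

lemma bead_flip:
  assumes b: "bead x y n p"
  shows "bead y x n p"
proof -
  have "link4 (p i) (p (i - 1)) y (p (Suc i)) x" if "i \<in> {1..n}" for i
    using link4_reverse[OF beadD(9)[OF b, of i]] that by simp
  then show ?thesis using b unfolding bead_def by simp
qed

lemma bead_extendable:
  assumes b: "bead x y n p"
    and f: "forest (induced G S)" "forest (induced G T)"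
    and d: "S \<inter> T = {}" "(S \<union> T) \<inter> p ` {1..n} = {}" and m: "B \<subseteq> S \<union> T"
    and c: "proper_col col"
    and e: "((x \<in> S \<longleftrightarrow> y \<in> S) \<longleftrightarrow> col x = col y) \<or>
      ((p 0 \<in> S \<longleftrightarrow> p (Suc n) \<in> S) \<longleftrightarrow> col (p 0) = col (p (Suc n)))"
  shows "extendable S T (p ` {1..n})"
proof -
  have xy: "x \<in> S \<union> T" "y \<in> S \<union> T" "p 0 \<in> S \<union> T" "p (Suc n) \<in> S \<union> T"
    using beadD(1,2,5,6)[OF b] m by blast+
  have d': "T \<inter> S = {}" "(T \<union> S) \<inter> p ` {1..n} = {}" using d by auto
  consider "x \<in> S" "y \<in> S" | "x \<in> T" "y \<in> T" | "x \<in> S" "y \<in> T" | "x \<in> T" "y \<in> S"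
    using xy by auto
  then show ?thesis
  proof cases
    case 1
    then show ?thesis using bead_extendable_same[OF b f d] by blast
  next
    case 2
    then show ?thesis using bead_extendable_same[OF b f(2,1) d'] extendable_swap by blast
  next
    case 3
    then have "y \<notin> S" using d by blast
    then have "(p 0 \<in> S \<longleftrightarrow> p (Suc n) \<in> S) \<longleftrightarrow> col (p 0) = col (p (Suc n))"
      using e 3 bead_colours(1)[OF b c] by simp
    then show ?thesis using bead_extendable_opposite[OF b f d 3 xy(3,4) c] by blast
  next
    case 4
    then have "x \<notin> S" using d by blast
    then have "(p 0 \<in> S \<longleftrightarrow> p (Suc n) \<in> S) \<longleftrightarrow> col (p 0) = col (p (Suc n))"
      using e 4 bead_colours(1)[OF b c] by simp
    then show ?thesis using bead_extendable_opposite[OF bead_flip[OF b] f d 4(2,1) xy(3,4) c] by blast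
  qed
qed

text \<open>A path edge makes a triangle with each pole. If the poles are in different forests, a
  monochromatic path edge would complete one of the two triangles in a forest; so membership
  alternates, as the colour does.\<close>

lemma bead_split:
  assumes b: "bead x y n p"
    and f: "forest (induced G S)" "forest (induced G T)" and st: "S \<union> T = verts G" "S \<inter> T = {}"
    and c: "proper_col col"
  shows "((x \<in> S \<longleftrightarrow> y \<in> S) \<longleftrightarrow> col x = col y) \<or>
      ((p 0 \<in> S \<longleftrightarrow> p (Suc n) \<in> S) \<longleftrightarrow> col (p 0) = col (p (Suc n)))"
proof (cases "x \<in> S \<longleftrightarrow> y \<in> S")
  case True
  then show ?thesis using bead_colours(1)[OF b c] by simp
next
  case False
  have alt: "p (Suc i) \<in> S \<longleftrightarrow> p i \<notin> S" if i: "i \<le> n" for i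
  proof -
    note e = tr_edges(1-3)[OF bead_tr(1)[OF b i]] tr_edges(1-3)[OF bead_tr(2)[OF b i]]
    have V: "p i \<in> S \<union> T" "p (Suc i) \<in> S \<union> T" "x \<in> S \<union> T" "y \<in> S \<union> T"
      unfolding st using edge_verts e by blast+
    have "\<not> {p i, p (Suc i), x} \<subseteq> S" "\<not> {p i, p (Suc i), x} \<subseteq> T"
      using not_mono_triangle[OF f(1) e(1-3)] not_mono_triangle[OF f(2) e(1-3)] by auto
    moreover have "\<not> {p i, p (Suc i), y} \<subseteq> S" "\<not> {p i, p (Suc i), y} \<subseteq> T"
      using not_mono_triangle[OF f(1) e(4-6)] not_mono_triangle[OF f(2) e(4-6)] by auto
    ultimately show ?thesis using V False by auto
  qed
  have "(p j \<in> S \<longleftrightarrow> p 0 \<in> S) \<longleftrightarrow> col (p j) = col (p 0)" if "j \<le> Suc n" for j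
    using that
  proof (induction j)
    case (Suc j)
    then show ?case using alt[of j] bead_colours(2)[OF b c, of j] by auto
  qed simp
  from this[of "Suc n"] show ?thesis by auto
qed

section \<open>Facial 4-cycles of \<open>G[B]\<close>\<close>

lemma bead_facial:
  assumes b: "bead x y n p"
  shows "facial_cycle (induced G B) [p 0, x, p (Suc n), y]"
proof -
  note bd = bead_boundary[OF b]
  have ce: "cycle_edges [p 0, x, p (Suc n), y] = {{p 0, x}, {x, p (Suc n)}, {p (Suc n), y}, {y, p 0}}"
    by (auto simp: cycle_edges_eq)
  have "is_cycle G [p 0, x, p (Suc n), y]"
    using bd B_verts beadD(1,2,5,6)[OF b] unfolding is_cycle_def ce by auto
  then have "is_cycle (induced G B) [p 0, x, p (Suc n), y]"
    unfolding is_cycle_induced using beadD(1,2,5,6)[OF b] by simp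
  then show ?thesis
    unfolding facial_cycle_def bounded_by_cycle_def ce
    using bead_region[OF b] by (intro bexI[of _ "region (p ` {1..n})"]) (auto simp: induced_def)
qed

text \<open>The diagonal \<open>{x, y}\<close> is not among the edges of the second cycle, hence not
  among those of the first, so it is a diagonal there too.\<close>

lemma opposite_in_four_cycle:
  assumes E: "{{a, b}, {b, c}, {c, d}, {d, a}} = {{w, x}, {x, z}, {z, y}, {y, w}}"
    and d: "distinct [a, b, c, d]" "distinct [w, x, z, y]"
  shows "{a, c} = {x, y} \<and> {b, d} = {w, z} \<or> {a, c} = {w, z} \<and> {b, d} = {x, y}"
proof -
  have V: "{a, b, c, d} = {w, x, z, y}"
  proof -
    have "\<Union>{{a, b}, {b, c}, {c, d}, {d, a}} = {a, b, c, d}" by auto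
    moreover have "\<Union>{{w, x}, {x, z}, {z, y}, {y, w}} = {w, x, z, y}" by auto
    ultimately show ?thesis using E by metis
  qed
  have "{x, y} \<notin> {{w, x}, {x, z}, {z, y}, {y, w}}" using d(2) by (auto simp: doubleton_eq_iff)
  then have na: "{x, y} \<noteq> {a, b}" "{x, y} \<noteq> {b, c}" "{x, y} \<noteq> {c, d}" "{x, y} \<noteq> {d, a}"
    unfolding E[symmetric] by auto
  have "x \<in> {a, b, c, d}" "y \<in> {a, b, c, d}" unfolding V by auto
  then have xy: "{x, y} = {a, c} \<or> {x, y} = {b, d}"
    using na d(2) by (auto simp: doubleton_eq_iff)
  have wz: "{w, z} = {a, b, c, d} - {x, y}" unfolding V using d(2) by auto
  have "{a, b, c, d} - {a, c} = {b, d}" "{a, b, c, d} - {b, d} = {a, c}" using d(1) by auto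
  then show ?thesis using xy wz by metis
qed

text \<open>The face of \<open>G[B]\<close> meets some face \<open>F0\<close> of \<open>G\<close>.
  If all corners of \<open>F0\<close> are big, both faces are equal; otherwise a small corner
  identifies the face with the star of its group.\<close>

lemma facial_four_cycle:
  assumes "facial_cycle (induced G B) [a, b, c, d]"
  obtains x y n p where "bead x y n p"
    "{a, c} = {x, y} \<and> {b, d} = {p 0, p (Suc n)} \<or> {a, c} = {p 0, p (Suc n)} \<and> {b, d} = {x, y}"
proof -
  let ?E = "{{a, b}, {b, c}, {c, d}, {d, a}}"
  have ce: "cycle_edges [a, b, c, d] = ?E" by (auto simp: cycle_edges_eq)
  obtain F where F: "F \<in> faces (induced G B)" and cyc: "is_cycle (induced G B) [a, b, c, d]"
    and fr': "frontier F = (\<Union>e\<in>?E. path_image (curve (induced G B) e))"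
    using assms unfolding facial_cycle_def bounded_by_cycle_def ce by blast
  have fr: "frontier F = carrier_of ?E" using fr' by (simp add: induced_def)
  have "is_cycle G [a, b, c, d]" using cyc is_cycle_induced by blast
  then have cyc: "distinct [a, b, c, d]" "?E \<subseteq> edges G"
    using ce unfolding is_cycle_def by auto
  \<comment> \<open>The count is what singles out the bead: in both other cases the frontier is
    carried by three edges.\<close>
  have cE: "card ?E = 4" using cyc(1) by (auto simp: doubleton_eq_iff card_insert_if)
  have no3: False if "?E \<subseteq> {e, f, g}" for e f g
  proof -
    have "card ?E \<le> card {e, f, g}" using that by (intro card_mono) auto
    also have "\<dots> \<le> 3" by (simp add: card_insert_if)
    finally show False using cE by simp
  qed
  have F': "F \<in> components (- support (induced G B))" using F by (simp add: faces_def)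
  have "closed (support (induced G B))"
  proof -
    have "finite (verts G \<inter> B)" "finite {e \<in> edges G. e \<subseteq> B}" using finite_verts finite_edges by auto
    then show ?thesis
      unfolding support_def induced_def
      by (simp, intro closed_Un closed_UN) (auto intro: closed_arc_of finite_imp_closed)
  qed
  then have "open F" using open_components[OF _ F'] by (simp add: open_Compl)
  moreover obtain q where "q \<in> F" using in_components_nonempty[OF F'] by blast
  then have "q \<in> closure F" using closure_subset by blast
  ultimately obtain F0 where F0: "F0 \<in> faces G" "q \<in> closure (F \<inter> F0)"
    by (rule closure_meets_face)
  then have meet: "F \<inter> F0 \<noteq> {}" by auto
  show thesis
  proof (cases "corners F0 \<subseteq> B")
    case True
    then have "F0 \<in> faces (induced G B)" using big_face F0 by blast
    then have "F = F0" using components_eqI F meet unfolding faces_def by metis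
    obtain u v w where t: "frontier F0 = carrier_of {{u, v}, {v, w}, {w, u}}"
      "{u, v} \<in> edges G" "{v, w} \<in> edges G" "{w, u} \<in> edges G"
      using face_triangle[OF F0(1)] by metis
    have "carrier_of ?E \<subseteq> carrier_of {{u, v}, {v, w}, {w, u}}"
      using fr t(1) \<open>F = F0\<close> by (metis order_refl)
    moreover have "{{u, v}, {v, w}, {w, u}} \<subseteq> edges G" using t(2-4) by simp
    ultimately have "?E \<subseteq> {{u, v}, {v, w}, {w, u}}"
      using carrier_subset_iff[OF cyc(2)] by metis
    then have False by (rule no3)
    then show thesis ..
  next
    case False
    then obtain v where v: "v \<in> corners F0" "v \<in> small" using corners_verts by (auto simp: small_def)
    have FR: "F = region C" if "region C \<in> faces (induced G B)" "v \<in> C" for C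
    proof -
      have "F0 \<subseteq> region C" using face_subset_region[OF F0(1)] v(1) that(2) by blast
      then have "F \<inter> region C \<noteq> {}" using meet by blast
      then show ?thesis using components_eqI F that(1) unfolding faces_def by metis
    qed
    show thesis
      using v(2)
    proof (cases rule: small_component_cases)
      case (triangle s t x y z)
      note r = small_triangle_region[OF triangle] and e = small_triangle_edges(1-3)[OF triangle]
      have "F = region {v, s, t}" using FR[OF r(1)] by simp
      then have "carrier_of ?E \<subseteq> carrier_of {{x, y}, {y, z}, {z, x}}"
        using r(2) unfolding fr[symmetric] by (simp only:)
      moreover have "{{x, y}, {y, z}, {z, x}} \<subseteq> edges G" using e by simp
      ultimately have "?E \<subseteq> {{x, y}, {y, z}, {z, x}}"
        using carrier_subset_iff[OF cyc(2)] by metis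
      then have False by (rule no3)
      then show thesis ..
    next
      case (bead x y n p)
      note r = bead_region[OF bead(1)] and e = bead_boundary[OF bead(1)]
      let ?D = "{{p 0, x}, {x, p (Suc n)}, {p (Suc n), y}, {y, p 0}}"
      have eq: "carrier_of ?E = carrier_of ?D"
        unfolding fr[symmetric] FR[OF r(1) bead(2)] by (rule r(2))
      have D: "?D \<subseteq> edges G" using e(1-4) by simp
      have "?E \<subseteq> ?D" by (rule carrier_subset_iff[OF cyc(2) D, THEN iffD1]) (simp only: eq order_refl)
      moreover have "?D \<subseteq> ?E"
        by (rule carrier_subset_iff[OF D cyc(2), THEN iffD1]) (simp only: eq order_refl)
      ultimately have "?E = ?D" by (rule equalityI)
      then show thesis using opposite_in_four_cycle[OF _ cyc(1) e(5)] that[OF bead(1)] by metis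
    qed
  qed
qed

text \<open>Groups of small vertices are added until none is left, organised as a choice of a
  largest set \<open>D\<close> of small vertices that can be placed.\<close>

lemma extend_all:
  assumes L: "two_partition B L1 L2" "forest (induced G L1)" "forest (induced G L2)"
    and c: "proper_col col"
    and e: "\<And>x y n p. bead x y n p \<Longrightarrow> ((x \<in> L1 \<longleftrightarrow> y \<in> L1) \<longleftrightarrow> col x = col y) \<or>
      ((p 0 \<in> L1 \<longleftrightarrow> p (Suc n) \<in> L1) \<longleftrightarrow> col (p 0) = col (p (Suc n)))"
  shows "\<exists>S T. two_partition (verts G) S T \<and> forest (induced G S) \<and> forest (induced G T)"
proof -
  have L12: "L1 \<union> L2 = B" "L1 \<inter> L2 = {}" using L(1) by (auto simp: two_partition_def)
  \<comment> \<open>Closure of \<open>D\<close> under small neighbours means that only entire groups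
    have been placed. The clause \<open>S \<inter> B = L1\<close> carries the hypothesis
    \<open>e\<close> over to the current parts.\<close>
  define P where "P D S T \<longleftrightarrow> D \<subseteq> small \<and> (\<forall>u\<in>D. nbrs u \<inter> small \<subseteq> D) \<and>
    S \<union> T = B \<union> D \<and> S \<inter> T = {} \<and> forest (induced G S) \<and> forest (induced G T) \<and> S \<inter> B = L1"
    for D S T
  have "P {} L1 L2" using L L12 unfolding P_def by auto
  moreover have "finite small" using finite_verts by (simp add: small_def)
  then have "card D < card small + 1" if "P D S T" for D S T
    using that card_mono[of small D] unfolding P_def by auto
  ultimately have "\<exists>D. (\<exists>S T. P D S T) \<and> (\<forall>D'. (\<exists>S T. P D' S T) \<longrightarrow> card D' \<le> card D)"
    by (intro ex_has_greatest_nat[where b = "card small + 1"]) blast+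
  then obtain D S T where D: "P D S T" and max: "\<And>D' S' T'. P D' S' T' \<Longrightarrow> card D' \<le> card D"
    by metis
  have DS: "D \<subseteq> small" "\<And>u. u \<in> D \<Longrightarrow> nbrs u \<inter> small \<subseteq> D" "S \<union> T = B \<union> D" "S \<inter> T = {}"
    "forest (induced G S)" "forest (induced G T)" "S \<inter> B = L1"
    using D unfolding P_def by auto
  have finD: "finite D" using DS(1) \<open>finite small\<close> finite_subset by blast
  have no_ext: False if C: "C \<subseteq> small" "C \<noteq> {}" "C \<inter> D = {}" "\<And>u. u \<in> C \<Longrightarrow> nbrs u \<inter> small \<subseteq> C"
      and ext: "extendable S T C" for C
  proof -
    obtain X where X: "X \<subseteq> C" "forest (induced G (S \<union> X))" "forest (induced G (T \<union> (C - X)))"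
      using ext unfolding extendable_def by blast
    have CB: "C \<inter> B = {}" using C(1) by (auto simp: small_def)
    have CST: "C \<inter> (S \<union> T) = {}" unfolding DS(3) using CB C(3) by blast
    have "P (D \<union> C) (S \<union> X) (T \<union> (C - X))"
      unfolding P_def
    proof (intro conjI ballI)
      show "D \<union> C \<subseteq> small" using DS(1) C(1) by blast
      show "nbrs u \<inter> small \<subseteq> D \<union> C" if "u \<in> D \<union> C" for u using that DS(2) C(4) by blast
      show "S \<union> X \<union> (T \<union> (C - X)) = B \<union> (D \<union> C)" using DS(3) X(1) by blast
      show "(S \<union> X) \<inter> (T \<union> (C - X)) = {}" using DS(4) CST X(1) by blast
      show "(S \<union> X) \<inter> B = L1" using DS(7) CB X(1) by blast
    qed (use X in auto)
    then have "card (D \<union> C) \<le> card D" by (rule max)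
    moreover have "finite C" using C(1) \<open>finite small\<close> finite_subset by blast
    ultimately have "card C = 0" using card_Un_disjoint[OF finD] C(3) by (simp add: Int_commute)
    then show False using \<open>finite C\<close> C(2) by simp
  qed
  have "D = small"
  proof (rule ccontr)
    assume "D \<noteq> small"
    then obtain v where v: "v \<in> small" "v \<notin> D" using DS(1) by blast
    show False
      using v(1)
    proof (cases rule: small_component_cases)
      case (triangle a b w y z)
      have s: "a \<in> small" "b \<in> small" and lv: "link4 v a b w y" and la: "link4 a v b z y"
        and lb: "link4 b v a z w"
        using triangle unfolding small_triangle_def by auto
      note nv = link4D(2)[OF lv] and na = link4D(2)[OF la] and nb = link4D(2)[OF lb]
      note big = small_triangle_bigs[OF triangle]
      have "a \<notin> D" "b \<notin> D" using DS(2)[of a] DS(2)[of b] na nb v by blast+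
      then have CD: "{v, a, b} \<inter> D = {}" using v by blast
      have cB: "{v, a, b} \<inter> B = {}" using v s by (auto simp: small_def)
      have "nbrs u \<inter> small \<subseteq> {v, a, b}" if "u \<in> {v, a, b}" for u
        using that nv na nb big by (auto simp: small_def)
      moreover have "(S \<union> T) \<inter> {v, a, b} = {}" unfolding DS(3) using CD cB by blast
      then have "extendable S T {v, a, b}"
        using small_triangle_extendable[OF triangle DS(5,6,4)] big DS(3) by blast
      ultimately show False using no_ext[of "{v, a, b}"] v s CD by blast
    next
      case (bead x y n p)
      let ?C = "p ` {1..n}"
      note b = beadD[OF bead(1)]
      have Cs: "?C \<subseteq> small" using b(8) by auto
      have CB: "?C \<inter> B = {}" using Cs by (auto simp: small_def)
      have nbC: "nbrs u \<inter> small \<subseteq> ?C" if uC: "u \<in> ?C" for u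
      proof -
        obtain i where i: "1 \<le> i" "i \<le> n" "u = p i" using uC by auto
        have "p j \<in> ?C" if "j \<le> Suc n" "p j \<in> small" for j
          using that b(5,6) by (cases "j = 0 \<or> j = Suc n") (auto simp: small_def)
        then have "p (i - 1) \<in> small \<Longrightarrow> p (i - 1) \<in> ?C" "p (Suc i) \<in> small \<Longrightarrow> p (Suc i) \<in> ?C"
          using i by auto
        moreover have "x \<notin> small" "y \<notin> small" using b(1,2) by (auto simp: small_def)
        ultimately show ?thesis using bead_nbrs[OF bead(1) i(1,2)] i(3) by auto
      qed
      \<comment> \<open>Consecutive small path vertices are neighbours, so a bead with its vertex
        \<open>v\<close> outside \<open>D\<close> is disjoint from \<open>D\<close>.\<close>
      have step: "p i \<in> D \<longleftrightarrow> p (Suc i) \<in> D" if i: "1 \<le> i" "i < n" for i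
      proof -
        have "{p i, p (Suc i)} \<in> edges G" using tr_edges(1)[OF bead_tr(1)[OF bead(1)]] i by simp
        then have "p (Suc i) \<in> nbrs (p i)" "p i \<in> nbrs (p (Suc i))"
          by (simp_all add: nbrs_def insert_commute)
        then show ?thesis using DS(2)[of "p i"] DS(2)[of "p (Suc i)"] b(8)[of i] b(8)[of "Suc i"] i
          by auto
      qed
      obtain j where j: "j \<in> {1..n}" "v = p j" using bead(2) by blast
      have "p i \<notin> D" if i: "i \<in> {1..n}" for i
      proof
        assume "p i \<in> D"
        then have "p j \<in> D"
          using interval_propagate[of 1 n "\<lambda>k. p k \<in> D" i j] step i j(1) by auto
        then show False using v j by simp
      qed
      then have CD: "?C \<inter> D = {}" by auto
      have CST: "(S \<union> T) \<inter> ?C = {}" unfolding DS(3) using CD CB by blast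
      have SL: "u \<in> S \<longleftrightarrow> u \<in> L1" if "u \<in> B" for u using DS(7) that by blast
      have "((x \<in> S \<longleftrightarrow> y \<in> S) \<longleftrightarrow> col x = col y) \<or>
          ((p 0 \<in> S \<longleftrightarrow> p (Suc n) \<in> S) \<longleftrightarrow> col (p 0) = col (p (Suc n)))"
        using e[OF bead(1)] SL[OF b(1)] SL[OF b(2)] SL[OF b(5)] SL[OF b(6)] by simp
      moreover have "B \<subseteq> S \<union> T" using DS(3) by blast
      ultimately have "extendable S T ?C" using bead_extendable[OF bead(1) DS(5,6,4) CST _ c] by blast
      moreover have "?C \<noteq> {}" using j by blast
      ultimately show False using no_ext[OF Cs _ CD nbC] by blast
    qed
  qed
  then have "S \<union> T = verts G" using DS(3) B_verts by (auto simp: small_def)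
  then show ?thesis using DS(4-6) unfolding two_partition_def by blast
qed

lemma proper_class_of:
  assumes V: "three_partition (verts G) V1 V2 V3"
    and i: "independent G V1" "independent G V2" "independent G V3"
  shows "proper_col (class_of V1 V2)"
  unfolding proper_col_def
proof (intro conjI allI impI)
  fix u v assume e: "{u, v} \<in> edges G"
  have "u \<in> V1 \<union> V2 \<union> V3" "v \<in> V1 \<union> V2 \<union> V3"
    using edge_verts[OF e] V unfolding three_partition_def by auto
  moreover have "\<not> (u \<in> V \<and> v \<in> V)" if "independent G V" for V
    using that e unfolding independent_def by blast
  ultimately show "class_of V1 V2 u \<noteq> class_of V1 V2 v"
    using i unfolding class_of_def by auto
qed (simp add: class_of_def)

text \<open>Beads and facial 4-cycles of \<open>G[B]\<close> correspond, with poles and ends as the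
  two diagonals. The listing of a cycle may name these in either order, which is harmless because
  the condition on a pair is symmetric.\<close>

lemma compatible_iff:
  assumes V: "three_partition (verts G) V1 V2 V3"
    and i: "independent G V1" "independent G V2" "independent G V3" and L: "two_partition B L1 L2"
  shows "compatible (induced G B) {B \<inter> V1, B \<inter> V2, B \<inter> V3} {L1, L2} \<longleftrightarrow>
    (\<forall>x y n p. bead x y n p \<longrightarrow>
      ((x \<in> L1 \<longleftrightarrow> y \<in> L1) \<longleftrightarrow> class_of V1 V2 x = class_of V1 V2 y) \<or>
      ((p 0 \<in> L1 \<longleftrightarrow> p (Suc n) \<in> L1) \<longleftrightarrow> class_of V1 V2 (p 0) = class_of V1 V2 (p (Suc n))))"
    (is "_ \<longleftrightarrow> (\<forall>x y n p. bead x y n p \<longrightarrow> ?good x y \<or> ?good (p 0) (p (Suc n)))")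
proof -
  let ?J = "{B \<inter> V1, B \<inter> V2, B \<inter> V3}" and ?K = "{L1, L2}"
  let ?pair = "\<lambda>u v. same_part ?K u v \<and> same_part ?J u v \<or> distinct_parts ?K u v \<and> distinct_parts ?J u v"
  have good: "?pair u v \<longleftrightarrow> ?good u v" if "u \<in> B" "v \<in> B" for u v
  proof -
    have "L1 \<inter> L2 = {}" "u \<in> L1 \<union> L2" "v \<in> L1 \<union> L2" using L that unfolding two_partition_def by auto
    from same_part_two[OF this] show ?thesis
      using same_part_three[OF V B_verts that] by blast
  qed
  have sym: "?good u v \<longleftrightarrow> ?good v u" for u v by auto
  have comp: "compatible (induced G B) ?J ?K \<longleftrightarrow>
      (\<forall>a b c d. facial_cycle (induced G B) [a, b, c, d] \<longrightarrow> ?pair a c \<or> ?pair b d)"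
    unfolding compatible_def by simp
  show ?thesis
    unfolding comp
  proof (intro iffI allI impI)
    fix x y n p
    assume a: "\<forall>a b c d. facial_cycle (induced G B) [a, b, c, d] \<longrightarrow> ?pair a c \<or> ?pair b d"
      and b: "bead x y n p"
    have "?pair (p 0) (p (Suc n)) \<or> ?pair x y" using a bead_facial[OF b] by blast
    then show "?good x y \<or> ?good (p 0) (p (Suc n))"
      using good[OF beadD(5,6)[OF b]] good[OF beadD(1,2)[OF b]] by blast
  next
    fix a b c d
    assume g: "\<forall>x y n p. bead x y n p \<longrightarrow> ?good x y \<or> ?good (p 0) (p (Suc n))"
      and f: "facial_cycle (induced G B) [a, b, c, d]"
    obtain x y n p where bd: "bead x y n p"
      and ac: "{a, c} = {x, y} \<and> {b, d} = {p 0, p (Suc n)} \<or> {a, c} = {p 0, p (Suc n)} \<and> {b, d} = {x, y}"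
      using facial_four_cycle[OF f] .
    have gd: "?good x y \<or> ?good (p 0) (p (Suc n))" using g bd by blast
    have B4: "{x, y} \<subseteq> B" "{p 0, p (Suc n)} \<subseteq> B" using beadD(1,2,5,6)[OF bd] by auto
    then have "{a, c} \<subseteq> B \<and> {b, d} \<subseteq> B" using ac by metis
    then have abcd: "a \<in> B" "b \<in> B" "c \<in> B" "d \<in> B" by auto
    have pair: "?good u v" if "{u, v} = {u', v'}" "?good u' v'" for u v u' v'
    proof -
      have "u = u' \<and> v = v' \<or> u = v' \<and> v = u'" using that(1) by (simp add: doubleton_eq_iff)
      then show ?thesis using that(2) sym[of u v] by (elim disjE conjE) simp_all
    qed
    from ac have "?good a c \<or> ?good b d"
    proof (elim disjE conjE)
      assume "{a, c} = {x, y}" "{b, d} = {p 0, p (Suc n)}"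
      then show ?thesis using gd pair[of a c x y] pair[of b d "p 0" "p (Suc n)"] by argo
    next
      assume "{a, c} = {p 0, p (Suc n)}" "{b, d} = {x, y}"
      then show ?thesis using gd pair[of b d x y] pair[of a c "p 0" "p (Suc n)"] by argo
    qed
    then show "?pair a c \<or> ?pair b d" using good abcd by blast
  qed
qed

end

theorem theorem2p1:
  fixes G :: drawn_graph and B V1 V2 V3 :: "complex set"
  assumes "eulerian_plane_triangulation G"
    and "B = big_verts G"
    and "card B \<ge> 3"
    and "three_partition (verts G) V1 V2 V3"
    and "independent G V1" "independent G V2" "independent G V3"
  shows "(\<exists>S T. two_partition (verts G) S T \<and> forest (induced G S) \<and> forest (induced G T))
    \<longleftrightarrow>
    (\<exists>L1 L2. two_partition B L1 L2 \<and>
       compatible (induced G B) {B \<inter> V1, B \<inter> V2, B \<inter> V3} {L1, L2} \<and>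
       forest (induced (induced G B) L1) \<and> forest (induced (induced G B) L2))"
proof -
  interpret eulerian_triangulation G
    using assms by unfold_locales auto
  note V = assms(4-7)
  note col = proper_class_of[OF V]
  show ?thesis
    unfolding assms(2)
  proof
    assume "\<exists>S T. two_partition (verts G) S T \<and> forest (induced G S) \<and> forest (induced G T)"
    then obtain S T where st: "S \<union> T = verts G" "S \<inter> T = {}" "forest (induced G S)" "forest (induced G T)"
      unfolding two_partition_def by blast
    let ?L1 = "big_verts G \<inter> S" and ?L2 = "big_verts G \<inter> T"
    have L: "two_partition (big_verts G) ?L1 ?L2"
      using st(1,2) B_verts unfolding two_partition_def by blast
    \<comment> \<open>Poles and ends of a bead are big, so restricting the parts to the big vertices
      does not affect their membership.\<close>
    have "((x \<in> ?L1 \<longleftrightarrow> y \<in> ?L1) \<longleftrightarrow> class_of V1 V2 x = class_of V1 V2 y) \<or>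
        ((p 0 \<in> ?L1 \<longleftrightarrow> p (Suc n) \<in> ?L1) \<longleftrightarrow> class_of V1 V2 (p 0) = class_of V1 V2 (p (Suc n)))"
      if b: "bead x y n p" for x y n p
      using bead_split[OF b st(3,4,1,2) col] beadD(1,2,5,6)[OF b] by simp
    then have "compatible (induced G (big_verts G))
        {big_verts G \<inter> V1, big_verts G \<inter> V2, big_verts G \<inter> V3} {?L1, ?L2}"
      unfolding compatible_iff[OF V L] by blast
    moreover have "forest (induced G (big_verts G \<inter> ?L1))" "forest (induced G (big_verts G \<inter> ?L2))"
      by (rule forest_induced_subset[OF st(3)] forest_induced_subset[OF st(4)]; blast)+
    ultimately show "\<exists>L1 L2. two_partition (big_verts G) L1 L2 \<and>
       compatible (induced G (big_verts G))
         {big_verts G \<inter> V1, big_verts G \<inter> V2, big_verts G \<inter> V3} {L1, L2} \<and>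
       forest (induced (induced G (big_verts G)) L1) \<and> forest (induced (induced G (big_verts G)) L2)"
      using L unfolding induced_induced by blast
  next
    assume "\<exists>L1 L2. two_partition (big_verts G) L1 L2 \<and>
       compatible (induced G (big_verts G))
         {big_verts G \<inter> V1, big_verts G \<inter> V2, big_verts G \<inter> V3} {L1, L2} \<and>
       forest (induced (induced G (big_verts G)) L1) \<and> forest (induced (induced G (big_verts G)) L2)"
    then obtain L1 L2 where L: "two_partition (big_verts G) L1 L2"
      and c: "compatible (induced G (big_verts G))
         {big_verts G \<inter> V1, big_verts G \<inter> V2, big_verts G \<inter> V3} {L1, L2}"
      and f: "forest (induced G (big_verts G \<inter> L1))" "forest (induced G (big_verts G \<inter> L2))"
      unfolding induced_induced by blast
    have "big_verts G \<inter> L1 = L1" "big_verts G \<inter> L2 = L2" using L unfolding two_partition_def by auto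
    then have f': "forest (induced G L1)" "forest (induced G L2)" using f by simp_all
    show "\<exists>S T. two_partition (verts G) S T \<and> forest (induced G S) \<and> forest (induced G T)"
      by (rule extend_all[OF L f' col]) (use c compatible_iff[OF V L] in blast)
  qed
qed

end
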